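(* Let $\alpha\in(0,1)$, let $P$ be a reference path distribution, let $L$ be the (real-valued, random) loss, and let $\mathcal{Q}_\rho=\{Q:\ \mathrm{KL}(Q\|P)\le\rho\}$ be the KL ball of radius $\rho$ around $P$. For $t\in\mathbb{R}$ put $\phi_t(z)=(z-t)_+$. Then for any $\eta>0$, $$\sup_{Q\in\mathcal{Q}_\rho}\mathrm{CVaR}^{Q}_\alpha(L)\ \le\ \min_{t\in\mathbb{R}}\Big\{t+\frac{1}{\alpha\eta}\Big(\rho+\log\mathbb{E}_P\big[e^{\eta\phi_t(L)}\big]\Big)\Big\}.$$ Moreover, assume that the per-state policy KL is bounded, $\mathrm{KL}(\pi'(\cdot|x)\,\|\,\pi_{\mathrm{ref}}(\cdot|x))\le\beta$ for all $x$ in the support, and that the induced pathwise KL radius satisfies $\rho\le C_{\mathrm{occ}}\,\beta$ for some constant $C_{\mathrm{occ}}$ depending on the horizon and on mixing/occupancy properties. Then the right-hand side above is upper-bounded by the same expression with $\rho$ replaced by $C_{\mathrm{occ}}\beta$. Hence, penalizing the per-state KL by $\lambda_{\mathrm{KL}}\cdot\mathbb{E}_x[\mathrm{KL}(\pi(\cdot|x)\,\|\,\pi_{\mathrm{ref}}(\cdot|x))]$ controls a KL distributionally-robust (worst case over a KL ball) upper bound on the CVaR surrogate and thus quantifies conservatism.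
   Context: $\mathrm{CVaR}^Q_\alpha(L)=\min_{t\in\mathbb{R}}\{t+\tfrac1\alpha\mathbb{E}_Q[\phi_t(L)]\}$ (Rockafellar–Uryasev form), where $\mathbb{E}_Q$ is expectation under $Q$. $\mathrm{KL}$ is the Kullback–Leibler divergence. $P$ is the simulator/behavior distribution over paths of a finite-horizon controlled process. $\pi(\cdot|x)$, $\pi'(\cdot|x)$ are stochastic policies (distributions over actions in state $x$), with $\pi'$ the updated policy, and $\pi_{\mathrm{ref}}$ is a reference policy. $\mathbb{E}_x$ is expectation over states $x$ drawn from the state occupancy of the policy, and $\lambda_{\mathrm{KL}}$ is a penalty coefficient in the policy-optimization objective. *)

theory Defs
  imports "HOL-Probability.Probability"
begin

section \<open>KL divergence and KL balls\<close>

text \<open>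
  \<^const>\<open>KL_divergence\<close> is a Bochner integral: it is unspecified when \<open>Q\<close> is not absolutely continuous
  with respect to \<open>P\<close>, and \<open>0\<close> when the log-density is not integrable. For probability measures
  the negative part of the log-density is always \<open>Q\<close>-integrable, so in both cases the true
  divergence is \<open>\<infinity>\<close>. The arguments of \<^const>\<open>KL_divergence\<close> are in the opposite order.
\<close>

definition kl_div :: "'a measure \<Rightarrow> 'a measure \<Rightarrow> ereal" where
  "kl_div Q P =
    (if absolutely_continuous P Q \<and> integrable Q (entropy_density (exp 1) P Q)
     then ereal (KL_divergence (exp 1) P Q) else \<infinity>)"

definition kl_ball :: "'a measure \<Rightarrow> ereal \<Rightarrow> 'a measure set" where
  "kl_ball P r = {Q. prob_space Q \<and> sets Q = sets P \<and> kl_div Q P \<le> r}"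

section \<open>CVaR and the robust upper bound\<close>

definition excess :: "real \<Rightarrow> real \<Rightarrow> real" where
  "excess t z = max 0 (z - t)"

text \<open>
  No integrability of the loss is assumed, so expectations of nonnegative quantities are taken in
  \<open>[0, \<infinity>]\<close> and the objectives are extended-real valued. The minima over \<open>t\<close> are written as infima.
\<close>

definition cvar_objective :: "real \<Rightarrow> 'a measure \<Rightarrow> ('a \<Rightarrow> real) \<Rightarrow> real \<Rightarrow> ereal" where
  "cvar_objective \<alpha> Q L t =
    ereal t + ereal (1 / \<alpha>) * enn2ereal (\<integral>\<^sup>+\<omega>. ennreal (excess t (L \<omega>)) \<partial>Q)"

definition cvar :: "real \<Rightarrow> 'a measure \<Rightarrow> ('a \<Rightarrow> real) \<Rightarrow> ereal" where
  "cvar \<alpha> Q L = (INF t. cvar_objective \<alpha> Q L t)"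

text \<open>\<open>log E\<^sub>P[f]\<close>, used only for \<open>f \<ge> 1\<close>, so that the value lies in \<open>[0, \<infinity>]\<close>.\<close>

definition ln_expectation :: "'a measure \<Rightarrow> ('a \<Rightarrow> real) \<Rightarrow> ereal" where
  "ln_expectation P f =
    (if (\<integral>\<^sup>+\<omega>. ennreal (f \<omega>) \<partial>P) = \<infinity> then \<infinity>
     else ereal (ln (enn2real (\<integral>\<^sup>+\<omega>. ennreal (f \<omega>) \<partial>P))))"

definition robust_objective ::
    "real \<Rightarrow> real \<Rightarrow> 'a measure \<Rightarrow> ('a \<Rightarrow> real) \<Rightarrow> ereal \<Rightarrow> real \<Rightarrow> ereal" where
  "robust_objective \<alpha> \<eta> P L r t =
    ereal t + ereal (1 / (\<alpha> * \<eta>)) * (r + ln_expectation P (\<lambda>\<omega>. exp (\<eta> * excess t (L \<omega>))))"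

definition robust_bound ::
    "real \<Rightarrow> real \<Rightarrow> 'a measure \<Rightarrow> ('a \<Rightarrow> real) \<Rightarrow> ereal \<Rightarrow> ereal" where
  "robust_bound \<alpha> \<eta> P L r = (INF t. robust_objective \<alpha> \<eta> P L r t)"

section \<open>Finite-horizon controlled processes\<close>

text \<open>
  \<open>X\<close> is the state space, \<open>A\<close> the action space, \<open>\<mu>\<close> the initial state distribution, and \<open>K h (x, a)\<close>
  the law of the state at time \<open>h + 1\<close> given state \<open>x\<close> and action \<open>a\<close> at time \<open>h\<close>.
\<close>

locale controlled_process =
  fixes X :: "'s measure" and A :: "'a measure"
    and \<mu> :: "'s measure" and K :: "nat \<Rightarrow> 's \<times> 'a \<Rightarrow> 's measure"
  assumes initial: "\<mu> \<in> space (prob_algebra X)"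
    and transition: "\<And>h. K h \<in> X \<Otimes>\<^sub>M A \<rightarrow>\<^sub>M prob_algebra X"

definition policy :: "'s measure \<Rightarrow> 'a measure \<Rightarrow> ('s \<Rightarrow> 'a measure) \<Rightarrow> bool" where
  "policy X A \<pi> \<longleftrightarrow> \<pi> \<in> X \<rightarrow>\<^sub>M prob_algebra A"

text \<open>
  A path of horizon \<open>H\<close> consists of the states at times \<open>0, \<dots>, H\<close> and the actions at times \<open>0, \<dots>, H - 1\<close>.
\<close>

definition path_space ::
    "'s measure \<Rightarrow> 'a measure \<Rightarrow> nat \<Rightarrow> ((nat \<Rightarrow> 's) \<times> (nat \<Rightarrow> 'a)) measure" where
  "path_space X A H = (\<Pi>\<^sub>M h\<in>{..H}. X) \<Otimes>\<^sub>M (\<Pi>\<^sub>M h\<in>{..<H}. A)"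

primrec path_law ::
    "'s measure \<Rightarrow> 'a measure \<Rightarrow> 's measure \<Rightarrow> (nat \<Rightarrow> 's \<times> 'a \<Rightarrow> 's measure) \<Rightarrow>
     ('s \<Rightarrow> 'a measure) \<Rightarrow> nat \<Rightarrow> ((nat \<Rightarrow> 's) \<times> (nat \<Rightarrow> 'a)) measure" where
  "path_law X A \<mu> K \<pi> 0 =
    distr \<mu> (path_space X A 0) (\<lambda>x. (\<lambda>h\<in>{..0}. x, \<lambda>h\<in>{..<0}. undefined))"
| "path_law X A \<mu> K \<pi> (Suc h) =
    path_law X A \<mu> K \<pi> h \<bind> (\<lambda>\<omega>.
      \<pi> (fst \<omega> h) \<bind> (\<lambda>a.
        distr (K h (fst \<omega> h, a)) (path_space X A (Suc h))
          (\<lambda>x. ((fst \<omega>)(Suc h := x), (snd \<omega>)(h := a)))))"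

text \<open>
  The normalised occupancy: the law of the state at a decision time drawn uniformly from
  \<open>0, \<dots>, H - 1\<close>.
\<close>

definition state_occupancy ::
    "'s measure \<Rightarrow> 'a measure \<Rightarrow> 's measure \<Rightarrow> (nat \<Rightarrow> 's \<times> 'a \<Rightarrow> 's measure) \<Rightarrow>
     ('s \<Rightarrow> 'a measure) \<Rightarrow> nat \<Rightarrow> 's measure" where
  "state_occupancy X A \<mu> K \<pi> H =
    uniform_count_measure {..<H} \<bind> (\<lambda>h. distr (path_law X A \<mu> K \<pi> H) X (\<lambda>\<omega>. fst \<omega> h))"

definition kl_penalty ::
    "real \<Rightarrow> 's measure \<Rightarrow> ('s \<Rightarrow> 'a measure) \<Rightarrow> ('s \<Rightarrow> 'a measure) \<Rightarrow> ereal" where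
  "kl_penalty lam d \<pi> \<pi>\<^sub>r\<^sub>e\<^sub>f =
    ereal lam * enn2ereal (\<integral>\<^sup>+x. e2ennreal (kl_div (\<pi> x) (\<pi>\<^sub>r\<^sub>e\<^sub>f x)) \<partial>d)"

lemma (in controlled_process) path_law_prob_algebra:
  assumes "policy X A \<pi>"
  shows "path_law X A \<mu> K \<pi> H \<in> space (prob_algebra (path_space X A H))"
proof (induction H)
  case 0
  have "(\<lambda>x. (\<lambda>h\<in>{..0::nat}. x, \<lambda>h\<in>{..<0::nat}. undefined)) \<in> X \<rightarrow>\<^sub>M path_space X A 0"
    unfolding path_space_def
    by (intro measurable_Pair measurable_restrict) auto
  from measurable_space[OF measurable_distr_prob_space[OF this] initial]
  show ?case by simp
next
  case (Suc h)
  note [measurable] = transition assms[unfolded policy_def]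
  let ?P = "path_space X A h"
  have fs [measurable]: "fst \<in> ?P \<rightarrow>\<^sub>M (\<Pi>\<^sub>M h\<in>{..h}. X)" "snd \<in> ?P \<rightarrow>\<^sub>M (\<Pi>\<^sub>M h\<in>{..<h}. A)"
    unfolding path_space_def by measurable
  have st [measurable]: "(\<lambda>\<omega>. fst \<omega> h) \<in> ?P \<rightarrow>\<^sub>M X"
    by (rule measurable_compose[OF fs(1) measurable_component_singleton]) auto
  have upd: "(\<lambda>z. ((fst (fst (fst z)))(Suc h := snd z), (snd (fst (fst z)))(h := snd (fst z))))
      \<in> (?P \<Otimes>\<^sub>M A) \<Otimes>\<^sub>M X \<rightarrow>\<^sub>M path_space X A (Suc h)"
    unfolding path_space_def[of X A "Suc h"]
    by (intro measurable_Pair measurable_fun_upd[where J="{..h}"] measurable_fun_upd[where J="{..<h}"])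
       (auto simp: lessThan_Suc)
  have "(\<lambda>(\<omega>, a). distr (K h (fst \<omega> h, a)) (path_space X A (Suc h))
          (\<lambda>x. ((fst \<omega>)(Suc h := x), (snd \<omega>)(h := a)))) \<in> ?P \<Otimes>\<^sub>M A \<rightarrow>\<^sub>M prob_algebra (path_space X A (Suc h))"
    unfolding case_prod_beta
    by (rule measurable_distr_prob_space2[where M=X])
       (use upd in \<open>auto simp: split_beta'\<close>)
  then have "(\<lambda>\<omega>. \<pi> (fst \<omega> h) \<bind> (\<lambda>a. distr (K h (fst \<omega> h, a)) (path_space X A (Suc h))
          (\<lambda>x. ((fst \<omega>)(Suc h := x), (snd \<omega>)(h := a))))) \<in> ?P \<rightarrow>\<^sub>M prob_algebra (path_space X A (Suc h))"
    by (intro measurable_bind_prob_space2[where N=A]) auto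
  from measurable_space[OF measurable_bind_prob_space[OF measurable_ident this] Suc]
  show ?case by simp
qed

end

theory Submission
  imports Defs
begin

text \<open>
  Everything rests on the variational formula of Donsker and Varadhan: \<open>KL(Q|P) \<le> c\<close> holds iff
  \<open>E\<^sub>Q f \<le> c + log E\<^sub>P e\<^sup>f\<close> for all bounded measurable \<open>f\<close>. Applied to \<open>\<eta>\<close> times the excess, it gives the
  robust bound for each fixed \<open>t\<close>. Both objectives attain their infimum because each is either
  \<open>\<infinity>\<close> for every \<open>t\<close>, or \<open>t\<close> plus \<open>1 / \<alpha>\<close> times a \<open>1\<close>-Lipschitz function of \<open>t\<close> that decreases at some rate \<open>p > \<alpha>\<close> near \<open>-\<infinity>\<close>.

  The variational formula also yields the chain inequality for the KL divergence of a composition of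
  a law with a kernel on arbitrary measurable spaces, where jointly measurable conditional densities
  need not exist. Iterating it along the path bounds the pathwise divergence by the sum over time
  of the expected per-state divergences, that is, by \<open>H\<close> times its mean under the occupancy.
\<close>

section \<open>The Donsker--Varadhan inequality\<close>

lemma integrable_bounded_prob:
  fixes f :: "'a \<Rightarrow> real"
  assumes "prob_space M" and [measurable]: "f \<in> borel_measurable M"
    and "\<And>x. x \<in> space M \<Longrightarrow> \<bar>f x\<bar> \<le> C"
  shows "integrable M f"
proof -
  interpret prob_space M by fact
  show ?thesis
    by (rule integrable_const_bound[where B=C]) (use assms in auto)
qed

lemma exp_integral_bounds:
  fixes f :: "'a \<Rightarrow> real"
  assumes "prob_space M" and [measurable]: "f \<in> borel_measurable M"
    and bd: "\<And>x. x \<in> space M \<Longrightarrow> \<bar>f x\<bar> \<le> C"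
  shows "integrable M (\<lambda>x. exp (f x))"
    and "exp (-C) \<le> (\<integral>x. exp (f x) \<partial>M)" and "(\<integral>x. exp (f x) \<partial>M) \<le> exp C"
proof -
  interpret prob_space M by fact
  have b: "exp (-C) \<le> exp (f x) \<and> exp (f x) \<le> exp C" if "x \<in> space M" for x
    using bd[OF that] by auto
  show i: "integrable M (\<lambda>x. exp (f x))"
    by (rule integrable_bounded_prob[where C="exp C"]) (use b assms(1) in auto)
  show "exp (-C) \<le> (\<integral>x. exp (f x) \<partial>M)"
    by (rule integral_ge_const[OF i]) (use b in auto)
  show "(\<integral>x. exp (f x) \<partial>M) \<le> exp C"
    by (rule integral_le_const[OF i]) (use b in auto)
qed

text \<open>With base \<open>exp 1\<close> the divergence becomes the Q-integral of
  \<open>ln (D x)\<close> for a real-valued density. The identification with \<open>RN_deriv\<close>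
  holds P-almost everywhere and passes to Q by absolute continuity; positivity of \<open>D\<close>
  is available only under Q.\<close>

lemma kl_density_obtain:
  assumes "prob_space P" "prob_space Q" and sets: "sets Q = sets P"
    and ac: "absolutely_continuous P Q"
  obtains D where "D \<in> borel_measurable P" "\<And>x. 0 \<le> (D x :: real)"
    "Q = density P (\<lambda>x. ennreal (D x))" "AE x in Q. 0 < D x"
    "AE x in Q. entropy_density (exp 1) P Q x = ln (D x)"
proof -
  interpret P: prob_space P by fact
  interpret Q: prob_space Q by fact
  have "finite_measure Q" by unfold_locales
  from P.real_RN_deriv[OF this ac sets] obtain D where
    D: "D \<in> borel_measurable P" "AE x in P. RN_deriv P Q x = ennreal (D x)"
       "AE x in Q. 0 < D x" "\<And>x. 0 \<le> D x" by blast
  have "Q = density P (RN_deriv P Q)"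
    using P.density_RN_deriv[OF ac sets] ..
  also have "\<dots> = density P (\<lambda>x. ennreal (D x))"
    using D by (intro density_cong) auto
  finally have Q: "Q = density P (\<lambda>x. ennreal (D x))" .
  have "AE x in Q. entropy_density (exp 1) P Q x = ln (D x)"
    using absolutely_continuous_AE[OF sets ac D(2)]
    by eventually_elim (simp add: entropy_density_def log_def D(4))
  with that D Q show thesis by blast
qed

text \<open>Apply ln y \<le> y - 1 to y = \<open>exp (f x) / (D x * Z)\<close>, the ratio of the
  density of the Gibbs law e^f P / Z to that of Q. Its Q-mean is at most 1, so integrating gives E_Q
  f - E_Q ln D - ln Z \<le> 0, and E_Q ln D is the divergence.\<close>

lemma donsker_varadhan_bounded:
  fixes f :: "'a \<Rightarrow> real"
  assumes P: "prob_space P" and Q: "prob_space Q" and sets: "sets Q = sets P"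
    and kl: "kl_div Q P \<le> ereal c"
    and f[measurable]: "f \<in> borel_measurable P"
    and bd: "\<And>x. x \<in> space P \<Longrightarrow> \<bar>f x\<bar> \<le> C"
  shows "(\<integral>x. f x \<partial>Q) \<le> c + ln (\<integral>x. exp (f x) \<partial>P)"
proof -
  interpret P: prob_space P by fact
  interpret Q: prob_space Q by fact
  from kl have ac: "absolutely_continuous P Q" and int: "integrable Q (entropy_density (exp 1) P Q)"
    and le: "KL_divergence (exp 1) P Q \<le> c"
    by (auto simp: kl_div_def split: if_splits)
  from kl_density_obtain[OF P Q sets ac] obtain D where
    D[measurable]: "D \<in> borel_measurable P" and D0: "\<And>x. 0 \<le> D x"
    and QD: "Q = density P (\<lambda>x. ennreal (D x))" and Dpos: "AE x in Q. 0 < D x"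
    and ent: "AE x in Q. entropy_density (exp 1) P Q x = ln (D x)" by blast
  have [measurable]: "D \<in> borel_measurable Q" "f \<in> borel_measurable Q"
    "entropy_density (exp 1) P Q \<in> borel_measurable Q"
    using D f measurable_entropy_density by (simp_all cong: measurable_cong_sets add: measurable_cong_sets[OF sets refl])
  have lnD: "integrable Q (\<lambda>x. ln (D x))"
    using int ent by (subst integrable_cong_AE[where g="entropy_density (exp 1) P Q"]) auto
  have lnD_le: "(\<integral>x. ln (D x) \<partial>Q) \<le> c"
    using le ent unfolding KL_divergence_def
    by (subst integral_cong_AE[where g="entropy_density (exp 1) P Q"]) auto
  have bdQ: "\<And>x. x \<in> space Q \<Longrightarrow> \<bar>f x\<bar> \<le> C"
    using bd sets_eq_imp_space_eq[OF sets] by auto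
  have intf: "integrable Q f"
    by (rule integrable_bounded_prob[OF Q _ bdQ]) auto
  define Z where "Z = (\<integral>x. exp (f x) \<partial>P)"
  note eb = exp_integral_bounds[OF P f bd]
  have Z: "Z > 0"
    using eb(2) unfolding Z_def by (meson exp_gt_zero less_le_trans)
  \<comment> \<open>Division by 0 gives 0, so the integrand is e^f / Z where D > 0 and 0 elsewhere.
    This is why the Q-mean below is only bounded by 1.\<close>
  have i1: "integrable P (\<lambda>x. D x *\<^sub>R (exp (f x) / (D x * Z)))"
    by (rule Bochner_Integration.integrable_bound[OF eb(1)[THEN integrable_divide, of Z]])
       (use Z in auto)
  have "integrable Q (\<lambda>x. exp (f x) / (D x * Z))"
    unfolding QD by (subst integrable_density) (use D0 i1 in auto)
  moreover have "(\<integral>x. exp (f x) / (D x * Z) \<partial>Q) \<le> 1"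
  proof -
    have "(\<integral>x. exp (f x) / (D x * Z) \<partial>Q) = (\<integral>x. D x *\<^sub>R (exp (f x) / (D x * Z)) \<partial>P)"
      unfolding QD by (subst integral_density) (use D0 in auto)
    also have "\<dots> \<le> (\<integral>x. exp (f x) / Z \<partial>P)"
      by (rule integral_mono[OF i1 integrable_divide[OF eb(1)]]) (use Z in auto)
    also have "\<dots> = 1" using Z by (simp add: Z_def)
    finally show ?thesis .
  qed
  moreover have "AE x in Q. f x - ln (D x) - ln Z \<le> exp (f x) / (D x * Z) - 1"
    using Dpos
  proof eventually_elim
    case (elim x)
    have "ln (exp (f x) / (D x * Z)) \<le> exp (f x) / (D x * Z) - 1"
      using elim Z by (intro ln_le_minus_one) auto
    then show ?case using elim Z by (simp add: ln_div ln_mult)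
  qed
  ultimately have "(\<integral>x. f x - ln (D x) - ln Z \<partial>Q) \<le> (\<integral>x. exp (f x) / (D x * Z) - 1 \<partial>Q)"
    using intf lnD by (intro integral_mono_AE) auto
  also have "\<dots> \<le> 0"
    using \<open>integrable Q (\<lambda>x. exp (f x) / (D x * Z))\<close> \<open>(\<integral>x. exp (f x) / (D x * Z) \<partial>Q) \<le> 1\<close>
    by (simp add: Q.prob_space)
  finally have "(\<integral>x. f x \<partial>Q) - (\<integral>x. ln (D x) \<partial>Q) - ln Z \<le> 0"
    using intf lnD by (simp add: Q.prob_space)
  with lnD_le show ?thesis by (simp add: Z_def)
qed

text \<open>Two families of test functions suffice: large multiples of the indicator of a P-null set
  force absolute continuity, and bounded truncations of ln D recover the divergence in the limit.
  Integrability of ln D has to come out of the limit as well, because \<open>kl_div\<close> is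
  \<infinity> without it.\<close>

lemma kl_div_leI:
  assumes P: "prob_space P" and Q: "prob_space Q" and sets: "sets Q = sets P"
    and dv: "\<And>f C. f \<in> borel_measurable P \<Longrightarrow> (\<And>x. x \<in> space P \<Longrightarrow> \<bar>f x\<bar> \<le> C) \<Longrightarrow>
      (\<integral>x. f x \<partial>Q) \<le> c + ln (\<integral>x. exp (f x) \<partial>P)"
  shows "kl_div Q P \<le> ereal c"
proof -
  interpret P: prob_space P by fact
  interpret Q: prob_space Q by fact
  have ac: "absolutely_continuous P Q"
    unfolding absolutely_continuous_def
  proof
    fix B assume B: "B \<in> null_sets P"
    then have [measurable]: "B \<in> sets P" "B \<in> sets Q" using sets by auto
    \<comment> \<open>The test function vanishes P-almost everywhere, so its exponential has mean 1
      and the logarithm drops out. A positive Q-measure of B would then make the left side unbounded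
      in n.\<close>
    have n: "n * measure Q B \<le> c" for n :: nat
    proof -
      have "(\<integral>x. real n * indicator B x \<partial>Q) \<le> c + ln (\<integral>x. exp (real n * indicator B x) \<partial>P)"
        by (rule dv[where C=n]) (auto simp: indicator_def)
      also have "(\<integral>x. exp (real n * indicator B x) \<partial>P) = (\<integral>x. 1 \<partial>P)"
      proof (rule integral_cong_AE)
        show "AE x in P. exp (real n * indicator B x) = (1::real)"
          using AE_not_in[OF B] by eventually_elim simp
      qed auto
      finally show ?thesis by (simp add: P.prob_space)
    qed
    have "measure Q B = 0"
    proof (rule ccontr)
      assume "measure Q B \<noteq> 0"
      then have "measure Q B > 0" by (simp add: zero_less_measure_iff)
      then obtain n :: nat where "c < n * measure Q B"
        using reals_Archimedean3 by blast
      with n[of n] show False by simp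
    qed
    then show "B \<in> null_sets Q" using \<open>B \<in> sets Q\<close> by (auto simp: null_sets_def Q.emeasure_eq_measure)
  qed
  from kl_density_obtain[OF P Q sets ac] obtain D where
    D[measurable]: "D \<in> borel_measurable P" and D0: "\<And>x. 0 \<le> D x"
    and QD: "Q = density P (\<lambda>x. ennreal (D x))" and Dpos: "AE x in Q. 0 < D x"
    and ent: "AE x in Q. entropy_density (exp 1) P Q x = ln (D x)" by blast
  have [measurable]: "D \<in> borel_measurable Q" 
    "entropy_density (exp 1) P Q \<in> borel_measurable Q"
    using D measurable_entropy_density by (simp_all cong: measurable_cong_sets add: measurable_cong_sets[OF sets refl])
  have intD: "integrable P D" and D1: "(\<integral>x. D x \<partial>P) = 1"
  proof -
    have "(\<integral>\<^sup>+x. ennreal (D x) \<partial>P) = 1"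
      using Q.emeasure_space_1 sets_eq_imp_space_eq[OF sets] unfolding QD
      by (simp add: emeasure_density cong: nn_integral_cong)
    then show "integrable P D" "(\<integral>x. D x \<partial>P) = 1"
      using D0 by (auto intro!: integrableI_nonneg simp: integral_eq_nn_integral)
  qed
  define neg where "neg x = max 0 (- ln (D x))" for x
  define pos where "pos x = max 0 (ln (D x))" for x
  have [measurable]: "neg \<in> borel_measurable Q" "pos \<in> borel_measurable Q" "neg \<in> borel_measurable P"
    unfolding neg_def pos_def by measurable
  \<comment> \<open>Under P the integrand is D times the negative part of ln D; for 0 < D < 1 it is
    at most 1 - D, by ln y \<le> y - 1 at y = 1 / D.\<close>
  have neg: "integrable Q neg"
  proof -
    have "\<bar>D x * neg x\<bar> \<le> 1" for x
    proof (cases "0 < D x \<and> D x < 1")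
      case True
      then have "- ln (D x) = ln (1 / D x)" by (simp add: ln_div)
      also have "\<dots> \<le> 1 / D x - 1" using True by (intro ln_le_minus_one) auto
      finally have "D x * neg x \<le> D x * (1 / D x - 1)"
        using True by (intro mult_left_mono) (auto simp: neg_def)
      also have "\<dots> \<le> 1" using True by (simp add: field_simps)
      finally have "D x * neg x \<le> 1" .
      moreover have "0 \<le> D x * neg x" using D0[of x] by (intro mult_nonneg_nonneg) (simp_all add: neg_def)
      ultimately show ?thesis by simp
    next
      case False
      then have "D x = 0 \<or> neg x = 0" using D0[of x] by (auto simp: neg_def max_def)
      then show ?thesis by auto
    qed
    then have "integrable P (\<lambda>x. D x *\<^sub>R neg x)"
      by (intro integrable_bounded_prob[OF P, where C=1]) auto
    then show ?thesis unfolding QD by (subst integrable_density) (use D0 in auto)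
  qed
  define N where "N = (\<integral>x. neg x \<partial>Q)"
  \<comment> \<open>Testing with \<open>ln\<close> of the clamped density keeps \<open>E\<^sub>P e\<^sup>f\<close> below \<open>1 + 1/(n+1)\<close>, also where \<open>D = 0\<close>.\<close>
  define cl where "cl n x = max (1 / real (n+1)) (min (real (n+1)) (D x))" for n x
  have cl: "1 / real (n+1) \<le> cl n x" "cl n x \<le> real (n+1)" for n x
    by (auto simp: cl_def field_simps)
  have cl0: "cl n x > 0" for n x
    using cl(1)[of n x] by (meson less_le_trans of_nat_0_less_iff zero_less_divide_1_iff add_gr_0 zero_less_one)
  have [measurable]: "cl n \<in> borel_measurable P" "cl n \<in> borel_measurable Q" for n
    unfolding cl_def by measurable
  have lncl: "\<bar>ln (cl n x)\<bar> \<le> ln (real (n+1))" for n x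
  proof -
    have "ln (1 / real (n+1)) \<le> ln (cl n x)" "ln (cl n x) \<le> ln (real (n+1))"
      using cl[of n x] cl0[of n x] by (auto intro!: ln_mono)
    then show ?thesis by (simp add: ln_div abs_le_iff)
  qed
  have intcl: "integrable Q (\<lambda>x. ln (cl n x))" for n
    by (rule integrable_bounded_prob[OF Q, where C="ln (real (n+1))"]) (use lncl in auto)
  have step: "(\<integral>x. ln (cl n x) \<partial>Q) \<le> c + 1 / real (n+1)" for n
  proof -
    have "(\<integral>x. ln (cl n x) \<partial>Q) \<le> c + ln (\<integral>x. exp (ln (cl n x)) \<partial>P)"
      by (rule dv[where C="ln (real (n+1))"]) (use lncl in auto)
    also have "(\<integral>x. exp (ln (cl n x)) \<partial>P) = (\<integral>x. cl n x \<partial>P)"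
      using cl0 by simp
    also have "ln (\<integral>x. cl n x \<partial>P) \<le> (\<integral>x. cl n x \<partial>P) - 1"
    proof (rule ln_le_minus_one)
      have "integrable P (cl n)"
        by (rule integrable_bounded_prob[OF P, where C="real (n+1)"]) (use cl cl0[of n] in \<open>auto simp: less_imp_le\<close>)
      then have "1 / real (n+1) \<le> (\<integral>x. cl n x \<partial>P)"
        by (rule P.integral_ge_const) (use cl in auto)
      then show "0 < (\<integral>x. cl n x \<partial>P)"
        by (meson less_le_trans of_nat_0_less_iff zero_less_divide_1_iff add_gr_0 zero_less_one)
    qed
    also have "(\<integral>x. cl n x \<partial>P) \<le> (\<integral>x. D x + 1 / real (n+1) \<partial>P)"
    proof (rule integral_mono)
      show "integrable P (cl n)"
        by (rule integrable_bounded_prob[OF P, where C="real (n+1)"]) (use cl cl0[of n] in \<open>auto simp: less_imp_le\<close>)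
      show "cl n x \<le> D x + 1 / real (n+1)" for x
        unfolding cl_def
        by (rule max.boundedI) (simp add: D0, rule order_trans[OF min.cobounded2], simp)
    qed (use intD in auto)
    also have "\<dots> = 1 + 1 / real (n+1)" using intD D1 by (simp add: P.prob_space)
    finally show ?thesis by simp
  qed
  \<comment> \<open>Clamping never pushes a value below the minimum of 1 and D, so minus
    \<open>neg\<close> is one integrable minorant for all n, as Fatou's lemma requires.\<close>
  have nonneg: "0 \<le> ln (cl n x) + neg x" if "D x > 0" for n x
  proof -
    have "min 1 (D x) \<le> cl n x" by (auto simp: cl_def)
    then have "ln (min 1 (D x)) \<le> ln (cl n x)" using that cl0[of n x] by (intro ln_mono) auto
    moreover have "ln (min 1 (D x)) = - neg x"
      using that by (auto simp: neg_def min_def max_def)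
    ultimately show ?thesis by simp
  qed
  \<comment> \<open>Once n exceeds both D and 1 / D the clamp is inactive, so the sequence is
    eventually constant.\<close>
  have lim: "(\<lambda>n. ln (cl n x) + neg x) \<longlonglongrightarrow> ln (D x) + neg x" if "D x > 0" for x
  proof -
    obtain m :: nat where m: "D x < m" using reals_Archimedean2 by blast
    obtain k :: nat where k: "1 / D x < k" using reals_Archimedean2 by blast
    have "cl n x = D x" if "n \<ge> max m k" for n
    proof -
      have "D x \<le> real (n+1)" using m that by auto
      moreover have "1 / real (n+1) \<le> D x"
      proof -
        have "1 / D x \<le> real (n+1)" using k that by auto
        then show ?thesis using \<open>D x > 0\<close> by (simp add: field_simps)
      qed
      ultimately show ?thesis by (auto simp: cl_def)
    qed
    then have "eventually (\<lambda>n. ln (cl n x) + neg x = ln (D x) + neg x) sequentially"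
      unfolding eventually_sequentially by (metis)
    then show ?thesis by (rule tendsto_eventually)
  qed
  have pos_eq: "ln (D x) + neg x = pos x" for x by (auto simp: pos_def neg_def)
  \<comment> \<open>Fatou applies after adding the integrable negative part of \<open>ln D\<close>.\<close>
  have fatou: "(\<integral>\<^sup>+x. ennreal (pos x) \<partial>Q) \<le> ennreal (c + N)"
  proof -
    have "(\<integral>\<^sup>+x. ennreal (pos x) \<partial>Q) = (\<integral>\<^sup>+x. liminf (\<lambda>n. ennreal (ln (cl n x) + neg x)) \<partial>Q)"
    proof (rule nn_integral_cong_AE)
      show "AE x in Q. ennreal (pos x) = liminf (\<lambda>n. ennreal (ln (cl n x) + neg x))"
        using Dpos
      proof eventually_elim
        case (elim x)
        have "(\<lambda>n. ennreal (ln (cl n x) + neg x)) \<longlonglongrightarrow> ennreal (pos x)"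
          using lim[OF elim] unfolding pos_eq by (rule tendsto_ennrealI)
        from lim_imp_Liminf[OF _ this] show ?case by simp
      qed
    qed
    also have "\<dots> \<le> liminf (\<lambda>n. \<integral>\<^sup>+x. ennreal (ln (cl n x) + neg x) \<partial>Q)"
      by (rule nn_integral_liminf) auto
    also have "\<dots> \<le> liminf (\<lambda>n. ennreal (c + N + 1 / real (n+1)))"
    proof (rule Liminf_mono, rule always_eventually, rule allI)
      fix n
      have "(\<integral>\<^sup>+x. ennreal (ln (cl n x) + neg x) \<partial>Q) = ennreal (\<integral>x. ln (cl n x) + neg x \<partial>Q)"
        by (rule nn_integral_eq_integral)
           (use intcl neg Dpos nonneg in \<open>auto elim!: eventually_mono\<close>)
      also have "(\<integral>x. ln (cl n x) + neg x \<partial>Q) \<le> c + N + 1 / real (n+1)"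
        using step[of n] intcl neg by (simp add: N_def)
      finally show "(\<integral>\<^sup>+x. ennreal (ln (cl n x) + neg x) \<partial>Q) \<le> ennreal (c + N + 1 / real (n+1))"
        by (simp add: ennreal_leI)
    qed
    also have "\<dots> = ennreal (c + N)"
    proof (rule lim_imp_Liminf)
      have "(\<lambda>n. c + N + 1 / real (n+1)) \<longlonglongrightarrow> c + N + 0"
        by (intro tendsto_intros LIMSEQ_Suc[OF lim_1_over_n, unfolded Suc_eq_plus1])
      then show "(\<lambda>n. ennreal (c + N + 1 / real (n+1))) \<longlonglongrightarrow> ennreal (c + N)"
        by (intro tendsto_ennrealI) simp
    qed simp
    finally show ?thesis .
  qed
  have pos: "integrable Q pos"
  proof (rule integrableI_nonneg)
    show "(\<integral>\<^sup>+x. ennreal (pos x) \<partial>Q) < \<infinity>" using fatou by (simp add: le_less_trans)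
  qed (auto simp: pos_def)
  \<comment> \<open>\<open>ennreal\<close> sends negative numbers to 0, so the Fatou bound can be
    read as a real inequality only when c + N \<ge> 0. The zero test function gives c \<ge>
    0.\<close>
  have cN: "0 \<le> c + N"
  proof -
    have "0 \<le> c" using dv[of "\<lambda>_. 0" 0] by (simp add: P.prob_space)
    moreover have "0 \<le> N" unfolding N_def by (rule Bochner_Integration.integral_nonneg) (simp add: neg_def)
    ultimately show ?thesis by simp
  qed
  have posle: "(\<integral>x. pos x \<partial>Q) \<le> c + N"
  proof -
    have "0 \<le> pos x" for x by (simp add: pos_def)
    then show ?thesis using fatou nn_integral_eq_integral[OF pos] cN by simp
  qed
  have eq: "ln (D x) = pos x - neg x" for x by (auto simp: pos_def neg_def)
  have lnD: "integrable Q (\<lambda>x. ln (D x))" unfolding eq using pos neg by simp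
  have lnD_le: "(\<integral>x. ln (D x) \<partial>Q) \<le> c" unfolding eq using pos neg posle by (simp add: N_def)
  have "integrable Q (entropy_density (exp 1) P Q)"
    using lnD ent by (subst integrable_cong_AE[where g="\<lambda>x. ln (D x)"]) auto
  moreover have "KL_divergence (exp 1) P Q \<le> c"
    unfolding KL_divergence_def using lnD_le ent
    by (subst integral_cong_AE[where g="\<lambda>x. ln (D x)"]) auto
  ultimately show ?thesis using ac by (simp add: kl_div_def)
qed

text \<open>The zero test function turns the variational inequality into 0 \<le> c.\<close>

lemma kl_div_nonneg:
  assumes "prob_space P" "prob_space Q" "sets Q = sets P"
  shows "0 \<le> kl_div Q P"
proof (cases "kl_div Q P")
  case (real c)
  have "(\<integral>x. 0 \<partial>Q) \<le> c + ln (\<integral>x. exp 0 \<partial>P)"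
    by (rule donsker_varadhan_bounded[OF assms, where C=0]) (auto simp: real)
  then show ?thesis using real assms(1) by (simp add: prob_space.prob_space)
qed (auto simp: kl_div_def split: if_splits)

text \<open>Jensen's inequality E_P f \<le> ln E_P e^f is exactly the variational criterion with c =
  0.\<close>

lemma kl_div_self:
  assumes "prob_space P"
  shows "kl_div P P \<le> 0"
proof -
  interpret prob_space P by fact
  have "kl_div P P \<le> ereal 0"
  proof (rule kl_div_leI[OF assms assms refl])
    fix f :: "'a \<Rightarrow> real" and C
    assume f: "f \<in> borel_measurable P" and bd: "\<And>x. x \<in> space P \<Longrightarrow> \<bar>f x\<bar> \<le> C"
    have "exp (\<integral>x. f x \<partial>P) \<le> (\<integral>x. exp (f x) \<partial>P)"
      by (rule jensens_inequality[where I=UNIV])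
         (use integrable_bounded_prob[OF assms f bd] exp_integral_bounds(1)[OF assms f bd] exp_convex in auto)
    from ln_mono[OF this] show "(\<integral>x. f x \<partial>P) \<le> 0 + ln (\<integral>x. exp (f x) \<partial>P)" by simp
  qed
  then show ?thesis by (simp add: zero_ereal_def)
qed

section \<open>Log-expectations of exponentials in the extended reals\<close>

lemma ln_expectation_exp_nonneg:
  assumes "prob_space P" and f0: "\<And>x. 0 \<le> f x"
  shows "0 \<le> ln_expectation P (\<lambda>x. exp (f x))"
proof (cases "(\<integral>\<^sup>+x. ennreal (exp (f x)) \<partial>P) = \<infinity>")
  case False
  have "(\<integral>\<^sup>+x. 1 \<partial>P) \<le> (\<integral>\<^sup>+x. ennreal (exp (f x)) \<partial>P)"
    by (rule nn_integral_mono) (use f0 in auto)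
  then have "1 \<le> (\<integral>\<^sup>+x. ennreal (exp (f x)) \<partial>P)"
    using assms(1) by (simp add: prob_space.emeasure_space_1)
  then have "1 \<le> enn2real (\<integral>\<^sup>+x. ennreal (exp (f x)) \<partial>P)"
    using False by (cases "\<integral>\<^sup>+x. ennreal (exp (f x)) \<partial>P") auto
  then show ?thesis using False by (simp add: ln_expectation_def)
qed (simp add: ln_expectation_def)

text \<open>A shift of the exponent by a multiplies the expectation by e^a. With f and g the scaled
  excesses at two thresholds, this makes the log-expectation Lipschitz in the threshold.\<close>

lemma ln_expectation_exp_le_add:
  assumes P: "prob_space P" and [measurable]: "g \<in> borel_measurable P"
    and f0: "\<And>x. 0 \<le> f x" and fg: "\<And>x. f x \<le> g x + a"
  shows "ln_expectation P (\<lambda>x. exp (f x)) \<le> ln_expectation P (\<lambda>x. exp (g x)) + ereal a"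
proof (cases "(\<integral>\<^sup>+x. ennreal (exp (g x)) \<partial>P) = \<infinity>")
  case False
  then obtain z where z: "(\<integral>\<^sup>+x. ennreal (exp (g x)) \<partial>P) = ennreal z" "0 \<le> z"
    by (cases "\<integral>\<^sup>+x. ennreal (exp (g x)) \<partial>P") auto
  have "(\<integral>\<^sup>+x. ennreal (exp (f x)) \<partial>P) \<le> (\<integral>\<^sup>+x. ennreal (exp a) * ennreal (exp (g x)) \<partial>P)"
    by (rule nn_integral_mono)
       (use fg in \<open>auto simp flip: ennreal_mult'' exp_add intro!: ennreal_leI simp: add.commute\<close>)
  also have "\<dots> = ennreal (exp a * z)"
    using z by (subst nn_integral_cmult) (auto simp: ennreal_mult'')
  finally have le: "(\<integral>\<^sup>+x. ennreal (exp (f x)) \<partial>P) \<le> ennreal (exp a * z)" .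
  then obtain y where y: "(\<integral>\<^sup>+x. ennreal (exp (f x)) \<partial>P) = ennreal y" "0 \<le> y"
    by (cases "\<integral>\<^sup>+x. ennreal (exp (f x)) \<partial>P") (auto simp: top_unique)
  have "(\<integral>\<^sup>+x. 1 \<partial>P) \<le> (\<integral>\<^sup>+x. ennreal (exp (f x)) \<partial>P)"
    by (rule nn_integral_mono) (use f0 in auto)
  \<comment> \<open>Since f \<ge> 0, the expectation y is at least 1. This makes z positive too, so
    that \<open>ln\<close> is monotone and splits the product.\<close>
  then have "1 \<le> y"
    using P y by (simp add: prob_space.emeasure_space_1)
  have "y \<le> exp a * z" using le y z by simp
  with \<open>1 \<le> y\<close> have "0 < exp a * z" by simp
  then have "0 < z" by (simp add: zero_less_mult_iff)
  have "ln y \<le> ln (exp a * z)" using \<open>1 \<le> y\<close> \<open>y \<le> exp a * z\<close> by (intro ln_mono) auto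
  also have "\<dots> = ln z + a" using \<open>0 < z\<close> by (simp add: ln_mult)
  finally show ?thesis using y z by (simp add: ln_expectation_def)
qed (simp add: ln_expectation_def)

text \<open>Truncating f at n makes the bounded inequality applicable, and Fatou's lemma removes the
  truncation. If the divergence or the exponential moment is infinite, the right side is
  \<infinity>, because both summands are nonnegative.\<close>

lemma donsker_varadhan_nonneg:
  assumes P: "prob_space P" and Q: "prob_space Q" and sets: "sets Q = sets P"
    and f[measurable]: "f \<in> borel_measurable P" and f0: "\<And>x. 0 \<le> f x"
  shows "enn2ereal (\<integral>\<^sup>+x. ennreal (f x) \<partial>Q) \<le> kl_div Q P + ln_expectation P (\<lambda>x. exp (f x))"
proof (cases "kl_div Q P = \<infinity> \<or> (\<integral>\<^sup>+x. ennreal (exp (f x)) \<partial>P) = \<infinity>")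
  case True
  then show ?thesis
    using kl_div_nonneg[OF P Q sets] ln_expectation_exp_nonneg[OF P f0]
    by (auto simp: ln_expectation_def)
next
  case False
  note nn = kl_div_nonneg[OF P Q sets] ln_expectation_exp_nonneg[where f=f, OF P f0]
  from False nn(1) obtain c where c: "kl_div Q P = ereal c" "0 \<le> c"
    by (cases "kl_div Q P") auto
  define Z where "Z = (\<integral>x. exp (f x) \<partial>P)"
  have int: "integrable P (\<lambda>x. exp (f x))"
    using False by (intro integrableI_nonneg) (auto simp: less_top)
  have lnZ: "ln_expectation P (\<lambda>x. exp (f x)) = ereal (ln Z)"
    using False by (simp add: ln_expectation_def Z_def integral_eq_nn_integral)
  \<comment> \<open>Nonnegativity of c + ln Z lets the bound move between \<open>ennreal\<close> and
    \<open>ereal\<close> without being cut off at 0.\<close>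
  with nn have Z0: "0 \<le> ln Z" by simp
  have [measurable]: "f \<in> borel_measurable Q"
    using f sets by (simp cong: measurable_cong_sets)
  have step: "(\<integral>\<^sup>+x. ennreal (min (f x) (real n)) \<partial>Q) \<le> ennreal (c + ln Z)" for n
  proof -
    have bd: "\<bar>min (f x) (real n)\<bar> \<le> real n" for x using f0[of x] by (auto simp: min_def)
    have m: "(\<lambda>x. min (f x) (real n)) \<in> borel_measurable P" by measurable
    have i: "integrable Q (\<lambda>x. min (f x) (real n))"
      by (rule integrable_bounded_prob[OF Q _ bd]) auto
    have "(\<integral>x. min (f x) (real n) \<partial>Q) \<le> c + ln (\<integral>x. exp (min (f x) (real n)) \<partial>P)"
      by (rule donsker_varadhan_bounded[OF P Q sets _ m bd]) (simp add: c)
    also have "ln (\<integral>x. exp (min (f x) (real n)) \<partial>P) \<le> ln Z"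
    proof (rule ln_mono)
      have "0 < exp (- real n)" by simp
      also have "\<dots> \<le> (\<integral>x. exp (min (f x) (real n)) \<partial>P)"
        by (rule exp_integral_bounds(2)[OF P m bd])
      finally show "0 < (\<integral>x. exp (min (f x) (real n)) \<partial>P)" .
      show "(\<integral>x. exp (min (f x) (real n)) \<partial>P) \<le> Z"
        unfolding Z_def by (rule integral_mono[OF exp_integral_bounds(1)[OF P m bd] int]) auto
    qed
    finally have "ennreal (\<integral>x. min (f x) (real n) \<partial>Q) \<le> ennreal (c + ln Z)"
      by (intro ennreal_leI) simp
    then show ?thesis
      by (subst nn_integral_eq_integral[OF i]) (use f0 in auto)
  qed
  have "(\<integral>\<^sup>+x. ennreal (f x) \<partial>Q) = (\<integral>\<^sup>+x. liminf (\<lambda>n. ennreal (min (f x) (real n))) \<partial>Q)"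
  proof (rule nn_integral_cong)
    fix x
    obtain m :: nat where m: "f x < m" using reals_Archimedean2 by blast
    have "eventually (\<lambda>n. ennreal (min (f x) (real n)) = ennreal (f x)) sequentially"
      using eventually_ge_at_top[of m] by eventually_elim (use m in auto)
    from lim_imp_Liminf[OF _ tendsto_eventually[OF this]]
    show "ennreal (f x) = liminf (\<lambda>n. ennreal (min (f x) (real n)))" by simp
  qed
  also have "\<dots> \<le> liminf (\<lambda>n. \<integral>\<^sup>+x. ennreal (min (f x) (real n)) \<partial>Q)"
    by (rule nn_integral_liminf) auto
  also have "\<dots> \<le> liminf (\<lambda>n::nat. ennreal (c + ln Z))"
    by (intro Liminf_mono always_eventually allI step)
  also have "\<dots> = ennreal (c + ln Z)" by (simp add: Liminf_const)
  finally have "enn2ereal (\<integral>\<^sup>+x. ennreal (f x) \<partial>Q) \<le> enn2ereal (ennreal (c + ln Z))"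
    by (simp add: less_eq_ennreal.rep_eq)
  then show ?thesis using c Z0 lnZ by (simp add: enn2ereal_ennreal del: ennreal_plus)
qed

section \<open>The chain inequality\<close>

text \<open>By \<open>kl_div_leI\<close> it is enough to test with a bounded f. The variational
  inequality is used twice: for each x between the two kernels, which leaves g x = ln of the mean of
  e^f under \<open>\<kappa> x\<close>, and then for g between Q and P. The inner and outer
  exponential means combine into one mean under the composed law. A measurable majorant B replaces
  the kernel divergence, whose measurability in x is not assumed.\<close>

lemma kl_div_bind_le:
  fixes B :: "'a \<Rightarrow> ennreal"
  assumes Q: "Q \<in> space (prob_algebra M)" and P: "P \<in> space (prob_algebra M)"
    and \<kappa>'[measurable]: "\<kappa>' \<in> M \<rightarrow>\<^sub>M prob_algebra N" and \<kappa>[measurable]: "\<kappa> \<in> M \<rightarrow>\<^sub>M prob_algebra N"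
    and B[measurable]: "B \<in> borel_measurable M"
    and le: "\<And>x. x \<in> space M \<Longrightarrow> kl_div (\<kappa>' x) (\<kappa> x) \<le> enn2ereal (B x)"
  shows "kl_div (Q \<bind> \<kappa>') (P \<bind> \<kappa>) \<le> kl_div Q P + enn2ereal (\<integral>\<^sup>+x. B x \<partial>Q)"
proof -
  from Q P have pQ: "prob_space Q" and pP: "prob_space P" and
    sQ[measurable_cong]: "sets Q = sets M" and sP[measurable_cong]: "sets P = sets M"
    by (auto simp: space_prob_algebra)
  note spQ = sets_eq_imp_space_eq[OF sQ] and spP = sets_eq_imp_space_eq[OF sP]
  have pk: "prob_space (\<kappa>' x)" "prob_space (\<kappa> x)" "sets (\<kappa>' x) = sets N" "sets (\<kappa> x) = sets N"
    "space (\<kappa> x) = space N" "space (\<kappa>' x) = space N"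
    if "x \<in> space M" for x
    using measurable_space[OF \<kappa>' that] measurable_space[OF \<kappa> that]
    by (auto simp: space_prob_algebra dest: sets_eq_imp_space_eq)
  have em: "emeasure (\<kappa>' x) (space N) = 1" "emeasure (\<kappa> x) (space N) = 1" if "x \<in> space M" for x
    using pk[OF that] prob_space.emeasure_space_1 by metis+
  have bQ: "Q \<bind> \<kappa>' \<in> space (prob_algebra N)" and bP: "P \<bind> \<kappa> \<in> space (prob_algebra N)"
    using measurable_space[OF measurable_bind_prob_space[OF measurable_ident \<kappa>'] Q]
      measurable_space[OF measurable_bind_prob_space[OF measurable_ident \<kappa>] P] by auto
  have \<kappa>'s: "\<kappa>' \<in> Q \<rightarrow>\<^sub>M subprob_algebra N" and \<kappa>s: "\<kappa> \<in> P \<rightarrow>\<^sub>M subprob_algebra N"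
    by (auto intro!: measurable_prob_algebraD)
  show ?thesis
  proof (cases "kl_div Q P = \<infinity> \<or> (\<integral>\<^sup>+x. B x \<partial>Q) = \<infinity>")
    case True
    then show ?thesis using kl_div_nonneg[OF pP pQ] sQ sP by (auto simp: ereal_plus_eq_PInfty)
  next
    case False
    then obtain c where c: "kl_div Q P = ereal c"
      by (cases "kl_div Q P") (auto simp: kl_div_def split: if_splits)
    obtain d where d: "(\<integral>\<^sup>+x. B x \<partial>Q) = ennreal d" "0 \<le> d"
      using False by (cases "\<integral>\<^sup>+x. B x \<partial>Q") auto
    interpret Q: prob_space Q by fact
    interpret P: prob_space P by fact
    \<comment> \<open>The bounded inequality takes a real constant, so B is replaced by a
      real-valued version where it is finite, which is Q-almost everywhere.\<close>
    have Bfin: "AE x in Q. B x \<noteq> \<infinity>"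
      by (rule nn_integral_noteq_infinite) (use False in auto)
    define b where "b x = enn2real (B x)" for x
    have [measurable]: "b \<in> borel_measurable M" unfolding b_def by measurable
    have "(\<integral>\<^sup>+x. ennreal (b x) \<partial>Q) = (\<integral>\<^sup>+x. B x \<partial>Q)"
      by (rule nn_integral_cong_AE) (use Bfin in \<open>auto elim!: eventually_mono simp: b_def less_top\<close>)
    then have b: "integrable Q b" "(\<integral>x. b x \<partial>Q) = d"
      using d by (auto intro!: integrableI_nonneg simp: integral_eq_nn_integral b_def)
    have "kl_div (Q \<bind> \<kappa>') (P \<bind> \<kappa>) \<le> ereal (c + d)"
    proof (rule kl_div_leI)
      show "prob_space (P \<bind> \<kappa>)" "prob_space (Q \<bind> \<kappa>')" "sets (Q \<bind> \<kappa>') = sets (P \<bind> \<kappa>)"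
        using bQ bP by (auto simp: space_prob_algebra)
      fix f :: "'b \<Rightarrow> real" and C
      assume f: "f \<in> borel_measurable (P \<bind> \<kappa>)" and bd: "\<And>x. x \<in> space (P \<bind> \<kappa>) \<Longrightarrow> \<bar>f x\<bar> \<le> C"
      have f'[measurable]: "f \<in> borel_measurable N"
        using f bP by (simp add: space_prob_algebra cong: measurable_cong_sets)
      have bd': "\<bar>f y\<bar> \<le> C" if "y \<in> space N" for y
        using bd bP that by (auto simp: space_prob_algebra dest: sets_eq_imp_space_eq)
      define g where "g x = ln (\<integral>y. exp (f y) \<partial>\<kappa> x)" for x
      have [measurable]: "g \<in> borel_measurable M"
        unfolding g_def
        by (intro borel_measurable_ln measurable_compose[OF measurable_prob_algebraD[OF \<kappa>] integral_measurable_subprob_algebra]) auto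
      have im: "(\<lambda>x. \<integral>y. f y \<partial>\<kappa>' x) \<in> borel_measurable M"
        by (intro measurable_compose[OF measurable_prob_algebraD[OF \<kappa>'] integral_measurable_subprob_algebra]) auto
      have fk: "f \<in> borel_measurable (\<kappa> x)" "f \<in> borel_measurable (\<kappa>' x)"
        "\<And>y. y \<in> space (\<kappa> x) \<Longrightarrow> \<bar>f y\<bar> \<le> C" "\<And>y. y \<in> space (\<kappa>' x) \<Longrightarrow> \<bar>f y\<bar> \<le> C" if "x \<in> space M" for x
        using pk[OF that] bd' by (auto cong: measurable_cong_sets)
      have eb: "exp (-C) \<le> (\<integral>y. exp (f y) \<partial>\<kappa> x)" "(\<integral>y. exp (f y) \<partial>\<kappa> x) \<le> exp C"
        if "x \<in> space M" for x
        using exp_integral_bounds(2,3)[OF pk(2)[OF that] fk(1,3)[OF that]] by auto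
      have gpos: "0 < (\<integral>y. exp (f y) \<partial>\<kappa> x)" if "x \<in> space M" for x
        using eb(1)[OF that] by (meson exp_gt_zero less_le_trans)
      have gb: "\<bar>g x\<bar> \<le> C" if "x \<in> space M" for x
      proof -
        have "ln (exp (-C)) \<le> g x" "g x \<le> ln (exp C)"
          unfolding g_def using eb[OF that] gpos[OF that] by (auto simp del: ln_exp intro!: ln_mono)
        then show ?thesis by simp
      qed
      have fb: "\<bar>\<integral>y. f y \<partial>\<kappa>' x\<bar> \<le> C" if x: "x \<in> space M" for x
      proof -
        interpret k: prob_space "\<kappa>' x" using pk[OF x] by simp
        have i: "integrable (\<kappa>' x) f"
          by (rule integrable_bounded_prob[OF _ fk(2,4)[OF x]]) (use pk[OF x] x in auto)
        have "(\<integral>y. f y \<partial>\<kappa>' x) \<le> C" "-C \<le> (\<integral>y. f y \<partial>\<kappa>' x)"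
          using fk(4)[OF x] by (auto intro!: k.integral_le_const k.integral_ge_const i simp: abs_le_iff minus_le_iff)
        then show ?thesis by simp
      qed
      have "(\<integral>x. f x \<partial>(Q \<bind> \<kappa>')) = (\<integral>x. \<integral>y. f y \<partial>\<kappa>' x \<partial>Q)"
        by (rule integral_bind[OF f' bd' \<kappa>'s, where B'=1])
           (use pk em spQ in \<open>auto intro!: AE_I2 simp: Q.finite_measure_axioms\<close>)
      also have "\<dots> \<le> (\<integral>x. b x + g x \<partial>Q)"
      proof (rule integral_mono_AE)
        show "integrable Q (\<lambda>x. \<integral>y. f y \<partial>\<kappa>' x)"
          by (rule integrable_bounded_prob[OF pQ, where C=C]) (use im fb spQ in auto)
        show "integrable Q (\<lambda>x. b x + g x)"
          using b integrable_bounded_prob[OF pQ, of g C] gb spQ by auto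
        show "AE x in Q. (\<integral>y. f y \<partial>\<kappa>' x) \<le> b x + g x"
          using Bfin AE_space
        proof eventually_elim
          case (elim x)
          then have x: "x \<in> space M" by (simp add: spQ)
          have "enn2ereal (B x) = ereal (b x)"
            using elim by (cases "B x") (auto simp: b_def)
          with le[OF x] show ?case unfolding g_def
            by (intro donsker_varadhan_bounded[OF _ _ _ _ fk(1,3)[OF x]]) (use pk[OF x] x in auto)
        qed
      qed
      also have "\<dots> = d + (\<integral>x. g x \<partial>Q)"
        using b integrable_bounded_prob[OF pQ, of g C] gb spQ by (subst Bochner_Integration.integral_add) auto
      \<comment> \<open>Second application, with g itself as the bounded test function; e^g then
        turns back into the inner exponential mean.\<close>
      also have "(\<integral>x. g x \<partial>Q) \<le> c + ln (\<integral>x. exp (g x) \<partial>P)"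
        by (rule donsker_varadhan_bounded[OF pP pQ, where C=C]) (use sQ sP c gb spP in auto)
      also have "(\<integral>x. exp (g x) \<partial>P) = (\<integral>x. \<integral>y. exp (f y) \<partial>\<kappa> x \<partial>P)"
        by (rule Bochner_Integration.integral_cong) (use gpos spP in \<open>auto simp: g_def\<close>)
      also have "\<dots> = (\<integral>x. exp (f x) \<partial>(P \<bind> \<kappa>))"
        by (rule integral_bind[OF _ _ \<kappa>s, where B'=1 and B="exp C", symmetric])
           (use pk em spP bd' in \<open>auto intro!: AE_I2 simp: P.finite_measure_axioms abs_le_iff\<close>)
      finally show "(\<integral>x. f x \<partial>(Q \<bind> \<kappa>')) \<le> c + d + ln (\<integral>x. exp (f x) \<partial>(P \<bind> \<kappa>))" by simp
    qed
    then show ?thesis using c d by (simp add: enn2ereal_ennreal)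
  qed
qed

text \<open>Data processing: the conditional laws coincide, so the chain inequality applies with B =
  0.\<close>

lemma kl_div_bind_same_kernel_le:
  assumes Q: "Q \<in> space (prob_algebra M)" and P: "P \<in> space (prob_algebra M)"
    and \<kappa>: "\<kappa> \<in> M \<rightarrow>\<^sub>M prob_algebra N"
  shows "kl_div (Q \<bind> \<kappa>) (P \<bind> \<kappa>) \<le> kl_div Q P"
proof -
  have "prob_space (\<kappa> x)" if "x \<in> space M" for x
    using measurable_space[OF \<kappa> that] by (simp add: space_prob_algebra)
  then have "kl_div (Q \<bind> \<kappa>) (P \<bind> \<kappa>) \<le> kl_div Q P + enn2ereal (\<integral>\<^sup>+x. 0 \<partial>Q)"
    by (intro kl_div_bind_le[OF Q P \<kappa> \<kappa>]) (auto simp: zero_ennreal.rep_eq intro: kl_div_self)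
  then show ?thesis by (simp add: zero_ennreal.rep_eq)
qed

section \<open>Path laws\<close>

text \<open>This isolates the part of a time step that does not depend on the policy, so that the
  steps under two policies differ only in the law of the action.\<close>

definition path_step ::
    "'s measure \<Rightarrow> 'a measure \<Rightarrow> (nat \<Rightarrow> 's \<times> 'a \<Rightarrow> 's measure) \<Rightarrow> nat \<Rightarrow>
     (nat \<Rightarrow> 's) \<times> (nat \<Rightarrow> 'a) \<Rightarrow> 'a \<Rightarrow> ((nat \<Rightarrow> 's) \<times> (nat \<Rightarrow> 'a)) measure" where
  "path_step X A K h \<omega> a = distr (K h (fst \<omega> h, a)) (path_space X A (Suc h))
     (\<lambda>x. ((fst \<omega>)(Suc h := x), (snd \<omega>)(h := a)))"

lemma path_law_Suc_step:
  "path_law X A \<mu> K \<pi> (Suc h) = path_law X A \<mu> K \<pi> h \<bind> (\<lambda>\<omega>. \<pi> (fst \<omega> h) \<bind> path_step X A K h \<omega>)"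
  by (simp add: path_step_def[abs_def])

lemma measurable_state:
  assumes "i \<le> h"
  shows "(\<lambda>\<omega>. fst \<omega> i) \<in> path_space X A h \<rightarrow>\<^sub>M X"
  unfolding path_space_def
  by (rule measurable_compose[OF measurable_fst measurable_component_singleton]) (use assms in auto)

context controlled_process
begin

lemma measurable_path_extend:
  assumes "\<omega> \<in> space (path_space X A h)" "a \<in> space A"
  shows "(\<lambda>x. ((fst \<omega>)(Suc h := x), (snd \<omega>)(h := a))) \<in> X \<rightarrow>\<^sub>M path_space X A (Suc h)"
  using assms unfolding path_space_def
  by (intro measurable_Pair measurable_fun_upd[where J="{..h}"] measurable_fun_upd[where J="{..<h}"])
     (auto simp: lessThan_Suc space_pair_measure)

lemma measurable_path_step:
  "(\<lambda>(\<omega>, a). path_step X A K h \<omega> a)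
     \<in> path_space X A h \<Otimes>\<^sub>M A \<rightarrow>\<^sub>M prob_algebra (path_space X A (Suc h))"
proof -
  note [measurable] = transition
  let ?P = "path_space X A h"
  have [measurable]: "(\<lambda>\<omega>. fst \<omega> h) \<in> ?P \<rightarrow>\<^sub>M X"
    by (rule measurable_state) simp
  have [measurable]: "fst \<in> ?P \<rightarrow>\<^sub>M (\<Pi>\<^sub>M h\<in>{..h}. X)" "snd \<in> ?P \<rightarrow>\<^sub>M (\<Pi>\<^sub>M h\<in>{..<h}. A)"
    unfolding path_space_def by measurable
  have "(\<lambda>z. ((fst (fst (fst z)))(Suc h := snd z), (snd (fst (fst z)))(h := snd (fst z))))
      \<in> (?P \<Otimes>\<^sub>M A) \<Otimes>\<^sub>M X \<rightarrow>\<^sub>M path_space X A (Suc h)"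
    unfolding path_space_def[of X A "Suc h"]
    by (intro measurable_Pair measurable_fun_upd[where J="{..h}"] measurable_fun_upd[where J="{..<h}"])
       (auto simp: lessThan_Suc)
  then show ?thesis
    unfolding case_prod_beta path_step_def
    by (intro measurable_distr_prob_space2[where M=X]) (auto simp: split_beta')
qed

lemma measurable_path_kernel:
  assumes "policy X A \<pi>"
  shows "(\<lambda>\<omega>. \<pi> (fst \<omega> h) \<bind> path_step X A K h \<omega>)
    \<in> path_space X A h \<rightarrow>\<^sub>M prob_algebra (path_space X A (Suc h))"
proof -
  note [measurable] = assms[unfolded policy_def] measurable_path_step
  have [measurable]: "(\<lambda>\<omega>. fst \<omega> h) \<in> path_space X A h \<rightarrow>\<^sub>M X"
    by (rule measurable_state) simp
  show ?thesis
    by (rule measurable_bind_prob_space2[where N=A]) auto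
qed

lemma policy_space:
  assumes "policy X A \<pi>" "x \<in> space X"
  shows "prob_space (\<pi> x)" "sets (\<pi> x) = sets A" "space (\<pi> x) = space A"
  using measurable_space[OF assms(1)[unfolded policy_def] assms(2)]
  by (auto simp: space_prob_algebra dest: sets_eq_imp_space_eq)

text \<open>Induction over the steps: the initial law is common to both sides, and the chain
  inequality adds at each step the mean divergence of the action laws at the current state. The mean
  at time i is taken under the path law of horizon i, not of horizon h.\<close>

lemma kl_div_path_law_le:
  assumes \<pi>: "policy X A \<pi>" and \<pi>': "policy X A \<pi>'"
    and meas: "(\<lambda>x. kl_div (\<pi> x) (\<pi>' x)) \<in> borel_measurable X"
  shows "kl_div (path_law X A \<mu> K \<pi> h) (path_law X A \<mu> K \<pi>' h)
    \<le> enn2ereal (\<Sum>i<h. \<integral>\<^sup>+\<omega>. e2ennreal (kl_div (\<pi> (fst \<omega> i)) (\<pi>' (fst \<omega> i))) \<partial>path_law X A \<mu> K \<pi> i)"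
proof (induction h)
  case 0
  have "path_law X A \<mu> K \<pi> 0 = path_law X A \<mu> K \<pi>' 0" by simp
  then show ?case
    using kl_div_self[of "path_law X A \<mu> K \<pi> 0"] path_law_prob_algebra[OF \<pi>, of 0]
    by (simp add: space_prob_algebra zero_ennreal.rep_eq)
next
  case (Suc h)
  let ?B = "\<lambda>\<omega>. e2ennreal (kl_div (\<pi> (fst \<omega> h)) (\<pi>' (fst \<omega> h)))"
  have st [measurable]: "(\<lambda>\<omega>. fst \<omega> h) \<in> path_space X A h \<rightarrow>\<^sub>M X"
    by (rule measurable_state) simp
  note [measurable] = meas
  have "kl_div (path_law X A \<mu> K \<pi> (Suc h)) (path_law X A \<mu> K \<pi>' (Suc h))
    \<le> kl_div (path_law X A \<mu> K \<pi> h) (path_law X A \<mu> K \<pi>' h) + enn2ereal (\<integral>\<^sup>+\<omega>. ?B \<omega> \<partial>path_law X A \<mu> K \<pi> h)"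
    unfolding path_law_Suc_step
  proof (rule kl_div_bind_le[OF path_law_prob_algebra[OF \<pi>] path_law_prob_algebra[OF \<pi>']
        measurable_path_kernel[OF \<pi>] measurable_path_kernel[OF \<pi>']])
    show "?B \<in> borel_measurable (path_space X A h)" by measurable
    fix \<omega> assume \<omega>: "\<omega> \<in> space (path_space X A h)"
    then have x: "fst \<omega> h \<in> space X" by (rule measurable_space[OF st])
    have G: "path_step X A K h \<omega> \<in> A \<rightarrow>\<^sub>M prob_algebra (path_space X A (Suc h))"
      using measurable_Pair2[OF measurable_path_step \<omega>] by simp
    \<comment> \<open>Along a fixed path both one-step laws are an action law followed by the same
      \<open>path_step\<close>, so by data processing only the action laws count.\<close>
    have "kl_div (\<pi> (fst \<omega> h) \<bind> path_step X A K h \<omega>) (\<pi>' (fst \<omega> h) \<bind> path_step X A K h \<omega>)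
        \<le> kl_div (\<pi> (fst \<omega> h)) (\<pi>' (fst \<omega> h))"
      by (rule kl_div_bind_same_kernel_le[OF _ _ G])
         (use policy_space[OF \<pi> x] policy_space[OF \<pi>' x] in \<open>auto simp: space_prob_algebra\<close>)
    also have "\<dots> = enn2ereal (?B \<omega>)"
      by (rule enn2ereal_e2ennreal[symmetric], rule kl_div_nonneg)
         (use policy_space[OF \<pi> x] policy_space[OF \<pi>' x] in auto)
    finally show "kl_div (\<pi> (fst \<omega> h) \<bind> path_step X A K h \<omega>) (\<pi>' (fst \<omega> h) \<bind> path_step X A K h \<omega>)
        \<le> enn2ereal (?B \<omega>)" .
  qed
  also have "\<dots> \<le> enn2ereal (\<Sum>i<h. \<integral>\<^sup>+\<omega>. e2ennreal (kl_div (\<pi> (fst \<omega> i)) (\<pi>' (fst \<omega> i))) \<partial>path_law X A \<mu> K \<pi> i)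
      + enn2ereal (\<integral>\<^sup>+\<omega>. ?B \<omega> \<partial>path_law X A \<mu> K \<pi> h)"
    by (rule add_right_mono[OF Suc.IH])
  finally show ?case by (simp add: plus_ennreal.rep_eq)
qed

section \<open>State marginals and the occupancy\<close>

lemma nn_integral_state_path_law_Suc:
  assumes \<pi>: "policy X A \<pi>" and g[measurable]: "g \<in> borel_measurable X" and i: "i \<le> h"
  shows "(\<integral>\<^sup>+\<omega>. g (fst \<omega> i) \<partial>path_law X A \<mu> K \<pi> (Suc h)) = (\<integral>\<^sup>+\<omega>. g (fst \<omega> i) \<partial>path_law X A \<mu> K \<pi> h)"
proof -
  note pl = path_law_prob_algebra[OF \<pi>, of h]
  have spl: "sets (path_law X A \<mu> K \<pi> h) = sets (path_space X A h)"
    using pl by (simp add: space_prob_algebra)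
  have gm: "(\<lambda>\<omega>. g (fst \<omega> i)) \<in> borel_measurable (path_space X A (Suc h))"
    by (rule measurable_compose[OF measurable_state g]) (use i in simp)
  have "(\<integral>\<^sup>+\<omega>. g (fst \<omega> i) \<partial>path_law X A \<mu> K \<pi> (Suc h)) =
      (\<integral>\<^sup>+\<omega>. \<integral>\<^sup>+\<omega>'. g (fst \<omega>' i) \<partial>(\<pi> (fst \<omega> h) \<bind> path_step X A K h \<omega>) \<partial>path_law X A \<mu> K \<pi> h)"
    unfolding path_law_Suc_step
    by (rule nn_integral_bind[OF gm])
       (use measurable_prob_algebraD[OF measurable_path_kernel[OF \<pi>]] spl in \<open>simp cong: measurable_cong_sets\<close>)
  also have "\<dots> = (\<integral>\<^sup>+\<omega>. g (fst \<omega> i) \<partial>path_law X A \<mu> K \<pi> h)"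
  proof (rule nn_integral_cong)
    fix \<omega> assume "\<omega> \<in> space (path_law X A \<mu> K \<pi> h)"
    then have \<omega>: "\<omega> \<in> space (path_space X A h)" using sets_eq_imp_space_eq[OF spl] by simp
    then have x: "fst \<omega> h \<in> space X" by (rule measurable_space[OF measurable_state[OF order_refl]])
    note ps = policy_space[OF \<pi> x]
    have G: "path_step X A K h \<omega> \<in> A \<rightarrow>\<^sub>M prob_algebra (path_space X A (Suc h))"
      using measurable_Pair2[OF measurable_path_step \<omega>] by simp
    have "(\<integral>\<^sup>+\<omega>'. g (fst \<omega>' i) \<partial>(\<pi> (fst \<omega> h) \<bind> path_step X A K h \<omega>)) =
        (\<integral>\<^sup>+a. \<integral>\<^sup>+\<omega>'. g (fst \<omega>' i) \<partial>path_step X A K h \<omega> a \<partial>\<pi> (fst \<omega> h))"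
      by (rule nn_integral_bind[OF gm])
         (use measurable_prob_algebraD[OF G] ps in \<open>simp cong: measurable_cong_sets\<close>)
    also have "\<dots> = (\<integral>\<^sup>+a. g (fst \<omega> i) \<partial>\<pi> (fst \<omega> h))"
    proof (rule nn_integral_cong)
      fix a assume "a \<in> space (\<pi> (fst \<omega> h))"
      then have a: "a \<in> space A" using ps by simp
      have K: "prob_space (K h (fst \<omega> h, a))" "sets (K h (fst \<omega> h, a)) = sets X"
        using measurable_space[OF transition, of "(fst \<omega> h, a)" h] x a
        by (auto simp: space_prob_algebra space_pair_measure)
      \<comment> \<open>The extension writes only the state coordinate \<open>Suc h\<close>, and i
        \<le> h, so the integrand is constant in the new state.\<close>
      have "(\<integral>\<^sup>+\<omega>'. g (fst \<omega>' i) \<partial>path_step X A K h \<omega> a) =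
          (\<integral>\<^sup>+x. g (fst \<omega> i) \<partial>K h (fst \<omega> h, a))"
        unfolding path_step_def
        by (subst nn_integral_distr)
           (use measurable_path_extend[OF \<omega> a] K i gm in \<open>auto cong: measurable_cong_sets\<close>)
      then show "(\<integral>\<^sup>+\<omega>'. g (fst \<omega>' i) \<partial>path_step X A K h \<omega> a) = g (fst \<omega> i)"
        using prob_space.emeasure_space_1[OF K(1)] by simp
    qed
    finally show "(\<integral>\<^sup>+\<omega>'. g (fst \<omega>' i) \<partial>(\<pi> (fst \<omega> h) \<bind> path_step X A K h \<omega>)) = g (fst \<omega> i)"
      using prob_space.emeasure_space_1[OF ps(1)] by simp
  qed
  finally show ?thesis .
qed

text \<open>The occupancy samples all times from the law of the full path, whereas the chain bound
  takes the mean at time i under the path of horizon i. Later steps leave the state at time i alone,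
  so the two agree.\<close>

lemma nn_integral_state_path_law:
  assumes \<pi>: "policy X A \<pi>" and g: "g \<in> borel_measurable X" and i: "i \<le> h"
  shows "(\<integral>\<^sup>+\<omega>. g (fst \<omega> i) \<partial>path_law X A \<mu> K \<pi> h) = (\<integral>\<^sup>+\<omega>. g (fst \<omega> i) \<partial>path_law X A \<mu> K \<pi> i)"
  using i
proof (induction h rule: dec_induct)
  case (step h)
  then show ?case using nn_integral_state_path_law_Suc[OF \<pi> g, of i h] by simp
qed simp

text \<open>The factor H cancels the weight 1 / H of the uniformly drawn decision time, which is
  possible because H \<ge> 1. The occupancy mean thereby becomes the sum over times that the chain
  bound produces.\<close>

lemma nn_integral_state_occupancy:
  assumes \<pi>: "policy X A \<pi>" and g[measurable]: "g \<in> borel_measurable X" and H: "H \<ge> 1"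
  shows "of_nat H * (\<integral>\<^sup>+x. g x \<partial>state_occupancy X A \<mu> K \<pi> H) =
    (\<Sum>i<H. \<integral>\<^sup>+\<omega>. g (fst \<omega> i) \<partial>path_law X A \<mu> K \<pi> i)"
proof -
  note pl = path_law_prob_algebra[OF \<pi>, of H]
  have spl: "sets (path_law X A \<mu> K \<pi> H) = sets (path_space X A H)" and ppl: "prob_space (path_law X A \<mu> K \<pi> H)"
    using pl by (auto simp: space_prob_algebra)
  have st: "(\<lambda>\<omega>. fst \<omega> i) \<in> path_law X A \<mu> K \<pi> H \<rightarrow>\<^sub>M X" if "i < H" for i
    using measurable_state[of i H X A] that spl by (simp cong: measurable_cong_sets)
  have d: "distr (path_law X A \<mu> K \<pi> H) X (\<lambda>\<omega>. fst \<omega> i) \<in> space (subprob_algebra X)" if "i < H" for i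
    using prob_space.prob_space_distr[OF ppl st[OF that]]
    by (auto simp: space_subprob_algebra prob_space_imp_subprob_space)
  have k: "(\<lambda>i. distr (path_law X A \<mu> K \<pi> H) X (\<lambda>\<omega>. fst \<omega> i))
      \<in> uniform_count_measure {..<H} \<rightarrow>\<^sub>M subprob_algebra X"
    using d by (auto simp: measurable_cong_sets[OF sets_uniform_count_measure_count_space refl])
  have "(\<integral>\<^sup>+x. g x \<partial>state_occupancy X A \<mu> K \<pi> H) =
      (\<integral>\<^sup>+i. \<integral>\<^sup>+x. g x \<partial>distr (path_law X A \<mu> K \<pi> H) X (\<lambda>\<omega>. fst \<omega> i) \<partial>uniform_count_measure {..<H})"
    unfolding state_occupancy_def by (rule nn_integral_bind[OF g k])
  also have "\<dots> = (\<Sum>i<H. ennreal (1 / real H) * (\<integral>\<^sup>+x. g x \<partial>distr (path_law X A \<mu> K \<pi> H) X (\<lambda>\<omega>. fst \<omega> i)))"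
    unfolding uniform_count_measure_def by (subst nn_integral_point_measure_finite) auto
  also have "\<dots> = (\<Sum>i<H. ennreal (1 / real H) * (\<integral>\<^sup>+\<omega>. g (fst \<omega> i) \<partial>path_law X A \<mu> K \<pi> i))"
    by (intro sum.cong refl arg_cong2[where f="(*)"], subst nn_integral_distr[OF st])
       (auto simp: g intro: nn_integral_state_path_law[OF \<pi> g])
  finally have "(\<integral>\<^sup>+x. g x \<partial>state_occupancy X A \<mu> K \<pi> H) =
      ennreal (1 / real H) * (\<Sum>i<H. \<integral>\<^sup>+\<omega>. g (fst \<omega> i) \<partial>path_law X A \<mu> K \<pi> i)"
    by (simp add: sum_distrib_left)
  moreover have "of_nat H * ennreal (1 / real H) = 1"
    using H by (simp add: ennreal_of_nat_eq_real_of_nat flip: ennreal_mult')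
  ultimately show ?thesis by (simp flip: mult.assoc)
qed

text \<open>Dividing the penalty by \<open>lam\<close> leaves the occupancy mean of the per-state
  divergence, and multiplying by H turns this mean into the sum in the chain bound. This is where
  the factor \<open>H / lam\<close> comes from.\<close>

lemma kl_div_path_law_le_kl_penalty:
  assumes \<pi>: "policy X A \<pi>" and \<pi>': "policy X A \<pi>'"
    and meas: "(\<lambda>x. kl_div (\<pi> x) (\<pi>' x)) \<in> borel_measurable X"
    and H: "H \<ge> 1" and lam: "lam > 0"
  shows "kl_div (path_law X A \<mu> K \<pi> H) (path_law X A \<mu> K \<pi>' H)
    \<le> ereal (H / lam) * kl_penalty lam (state_occupancy X A \<mu> K \<pi> H) \<pi> \<pi>'"
proof -
  let ?g = "\<lambda>x. e2ennreal (kl_div (\<pi> x) (\<pi>' x))"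
  have g: "?g \<in> borel_measurable X" using meas by measurable
  have "enn2ereal (\<Sum>i<H. \<integral>\<^sup>+\<omega>. ?g (fst \<omega> i) \<partial>path_law X A \<mu> K \<pi> i)
      = enn2ereal (ennreal (real H) * (\<integral>\<^sup>+x. ?g x \<partial>state_occupancy X A \<mu> K \<pi> H))"
    using nn_integral_state_occupancy[OF \<pi> g H] by (simp add: ennreal_of_nat_eq_real_of_nat)
  also have "\<dots> = ereal (H / lam) * (ereal lam * enn2ereal (\<integral>\<^sup>+x. ?g x \<partial>state_occupancy X A \<mu> K \<pi> H))"
    using lam by (simp add: times_ennreal.rep_eq enn2ereal_ennreal flip: mult.assoc)
  finally show ?thesis
    using kl_div_path_law_le[OF \<pi> \<pi>' meas, of H] by (simp add: kl_penalty_def)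
qed

end

section \<open>Attainment and the robust bound\<close>

text \<open>In the finite case the objective F is continuous by the Lipschitz bound and coercive by
  \<open>lower\<close>: to the right F t \<ge> t + b / \<alpha>, and to the left the slope p /
  \<alpha> > 1 outweighs the term t. A minimum over a compact interval is then global.\<close>

lemma INF_affine_plus_lipschitz_attained:
  fixes \<Psi> :: "real \<Rightarrow> ereal"
  assumes "0 < \<alpha>" "\<alpha> < p"
    and lip: "\<And>s t. \<Psi> s \<le> \<Psi> t + ereal \<bar>s - t\<bar>"
    and lower: "\<And>t. ereal (b + max 0 (p * (m - t))) \<le> \<Psi> t"
  shows "\<exists>t. (INF s. ereal s + ereal (1 / \<alpha>) * \<Psi> s) = ereal t + ereal (1 / \<alpha>) * \<Psi> t"
proof (cases "\<Psi> 0 = \<infinity>")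
  case True
  have "\<Psi> t = \<infinity>" for t
    using lip[of 0 t] True by (cases "\<Psi> t") auto
  then show ?thesis using assms(1) by auto
next
  case False
  \<comment> \<open>One finite value of \<Psi> makes all values finite from above by the Lipschitz
    bound, and \<open>lower\<close> excludes minus infinity.\<close>
  have "\<exists>r. \<Psi> t = ereal r" for t
    using lip[of t 0] lower[of t] False by (cases "\<Psi> t"; cases "\<Psi> 0") auto
  then obtain \<psi> where \<psi>: "\<And>t. \<Psi> t = ereal (\<psi> t)" by metis
  define F where "F t = t + \<psi> t / \<alpha>" for t
  have lip': "\<psi> s \<le> \<psi> t + \<bar>s - t\<bar>" for s t using lip[of s t] by (simp add: \<psi>)
  have low: "b \<le> \<psi> t" "b + p * (m - t) \<le> \<psi> t" for t
    using lower[of t] by (simp_all add: \<psi>)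
  have "1-lipschitz_on UNIV \<psi>"
  proof (rule lipschitz_onI)
    show "dist (\<psi> s) (\<psi> t) \<le> 1 * dist s t" for s t
      using lip'[of s t] lip'[of t s] abs_minus_commute[of s t]
      unfolding dist_real_def mult_1 by (intro abs_leI) linarith+
  qed simp
  then have "continuous_on UNIV \<psi>" by (rule lipschitz_on_continuous_on)
  then have cont: "continuous_on S F" for S
    unfolding F_def by (intro continuous_intros) (use assms(1) in \<open>auto intro: continuous_on_subset\<close>)
  define k where "k = p / \<alpha> - 1"
  have k: "k > 0" using assms(1,2) by (simp add: k_def field_simps)
  \<comment> \<open>\<open>lo\<close> and \<open>hi\<close> are the points beyond which the two
    affine lower bounds of F exceed F 0. Cutting off at 0 keeps 0 in the interval, so the minimum
    over the interval is at most F 0.\<close>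
  define lo where "lo = min 0 (((b + p * m) / \<alpha> - F 0) / k)"
  define hi where "hi = max 0 (F 0 - b / \<alpha>)"
  have "\<exists>t\<in>{lo..hi}. \<forall>s\<in>{lo..hi}. F t \<le> F s"
    by (rule continuous_attains_inf[OF _ _ cont]) (auto simp: lo_def hi_def)
  then obtain t where t: "\<And>s. s \<in> {lo..hi} \<Longrightarrow> F t \<le> F s" by blast
  have t0: "F t \<le> F 0" by (rule t) (auto simp: lo_def hi_def)
  have min: "F t \<le> F s" for s
  proof -
    consider "s \<in> {lo..hi}" | "hi < s" | "s < lo" by fastforce
    then show ?thesis
    proof cases
      case 2
      then have "F 0 - b / \<alpha> < s" by (simp add: hi_def)
      moreover have "b / \<alpha> \<le> \<psi> s / \<alpha>" using low(1)[of s] assms(1) by (intro divide_right_mono) auto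
      ultimately show ?thesis using t0 by (simp add: F_def)
    next
      case 3
      then have "s < ((b + p * m) / \<alpha> - F 0) / k" by (simp add: lo_def)
      then have "k * s < (b + p * m) / \<alpha> - F 0" using k by (simp add: pos_less_divide_eq mult.commute)
      moreover have "(b + p * (m - s)) / \<alpha> \<le> \<psi> s / \<alpha>" using low(2)[of s] assms(1) by (intro divide_right_mono) auto
      moreover have "(b + p * (m - s)) / \<alpha> = (b + p * m) / \<alpha> - (k + 1) * s"
        using assms(1) by (simp add: k_def field_simps)
      ultimately have "F 0 \<le> F s" by (simp add: F_def algebra_simps)
      then show ?thesis using t0 by simp
    qed (rule t)
  qed
  have F: "ereal s + ereal (1 / \<alpha>) * \<Psi> s = ereal (F s)" for s by (simp add: \<psi> F_def)
  have "(INF s. ereal (F s)) = ereal (F t)"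
    by (intro antisym INF_lower INF_greatest) (simp_all add: min)
  then show ?thesis unfolding F by blast
qed

section \<open>The excess, upper tails and attainment of the CVaR\<close>

lemma excess_nonneg: "0 \<le> excess t z"
  by (simp add: excess_def)

lemma excess_le_add: "excess s z \<le> excess t z + \<bar>s - t\<bar>"
  by (auto simp: excess_def)

lemma measurable_excess [measurable (raw)]:
  assumes [measurable]: "L \<in> borel_measurable M"
  shows "(\<lambda>\<omega>. excess t (L \<omega>)) \<in> borel_measurable M"
  unfolding excess_def by measurable

text \<open>L is real-valued, so the events -n \<le> L increase to the whole space and their
  probabilities tend to 1 > \<alpha>. The tail probability will be the slope p > \<alpha> of the
  attainment lemma.\<close>

lemma (in prob_space) upper_tail_prob_gt:
  assumes [measurable]: "L \<in> borel_measurable M" and "\<alpha> < 1"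
  obtains m :: real where "\<alpha> < prob {\<omega> \<in> space M. m \<le> L \<omega>}"
proof -
  let ?A = "\<lambda>n::nat. {\<omega> \<in> space M. - real n \<le> L \<omega>}"
  have "(\<lambda>n. prob (?A n)) \<longlonglongrightarrow> prob (\<Union>n. ?A n)"
    by (rule finite_Lim_measure_incseq) (auto simp: incseq_def)
  moreover have "(\<Union>n. ?A n) = space M"
  proof -
    have "\<exists>n. - real n \<le> L \<omega>" for \<omega>
      using real_arch_simple[of "- L \<omega>"] by (auto simp: minus_le_iff)
    then show ?thesis by auto
  qed
  ultimately have "(\<lambda>n. prob (?A n)) \<longlonglongrightarrow> 1" by (simp add: prob_space)
  from order_tendstoD(1)[OF this assms(2)] obtain n where "\<alpha> < prob (?A n)"
    by (auto simp: eventually_sequentially)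
  then show thesis by (rule that)
qed

text \<open>A Markov-type bound: on the tail event the excess is at least the positive part of m -
  t. It supplies the linear growth for t near minus infinity.\<close>

lemma (in prob_space) nn_integral_excess_ge:
  assumes [measurable]: "L \<in> borel_measurable M"
  shows "ereal (max 0 (prob {\<omega> \<in> space M. m \<le> L \<omega>} * (m - t)))
    \<le> enn2ereal (\<integral>\<^sup>+\<omega>. ennreal (excess t (L \<omega>)) \<partial>M)"
proof -
  let ?A = "{\<omega> \<in> space M. m \<le> L \<omega>}"
  have "max 0 (prob ?A * (m - t)) = max 0 (m - t) * prob ?A"
  proof (cases "t \<le> m")
    case False
    then have "prob ?A * (m - t) \<le> 0" by (intro mult_nonneg_nonpos) auto
    then show ?thesis using False by (simp add: max_absorb1)
  qed (simp add: max_absorb2 mult.commute)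
  then have "ennreal (max 0 (prob ?A * (m - t))) = (\<integral>\<^sup>+\<omega>. ennreal (max 0 (m - t)) * indicator ?A \<omega> \<partial>M)"
    by (subst nn_integral_cmult_indicator) (auto simp: emeasure_eq_measure ennreal_mult'')
  also have "\<dots> \<le> (\<integral>\<^sup>+\<omega>. ennreal (excess t (L \<omega>)) \<partial>M)"
    by (rule nn_integral_mono) (auto simp: excess_def indicator_def intro!: ennreal_leI)
  finally show ?thesis
    unfolding less_eq_ennreal.rep_eq by (subst (asm) enn2ereal_ennreal) simp_all
qed

text \<open>The mean excess plays the part of \<Psi>, with b = 0 and the tail probability as p. It
  is 1-Lipschitz in t because the excess is and Q has mass 1.\<close>

lemma cvar_attained:
  assumes Q: "prob_space Q" and L[measurable]: "L \<in> borel_measurable Q" and \<alpha>: "0 < \<alpha>" "\<alpha> < 1"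
  shows "\<exists>t. cvar \<alpha> Q L = cvar_objective \<alpha> Q L t"
proof -
  interpret prob_space Q by fact
  obtain m where m: "\<alpha> < prob {\<omega> \<in> space Q. m \<le> L \<omega>}"
    using upper_tail_prob_gt[OF L \<alpha>(2)] .
  have lip: "enn2ereal (\<integral>\<^sup>+\<omega>. ennreal (excess s (L \<omega>)) \<partial>Q)
      \<le> enn2ereal (\<integral>\<^sup>+\<omega>. ennreal (excess t (L \<omega>)) \<partial>Q) + ereal \<bar>s - t\<bar>" for s t
  proof -
    have "(\<integral>\<^sup>+\<omega>. ennreal (excess s (L \<omega>)) \<partial>Q) \<le> (\<integral>\<^sup>+\<omega>. ennreal (excess t (L \<omega>)) + ennreal \<bar>s - t\<bar> \<partial>Q)"
      by (rule nn_integral_mono)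
         (auto simp: excess_nonneg simp flip: ennreal_plus intro!: ennreal_leI excess_le_add)
    also have "\<dots> = (\<integral>\<^sup>+\<omega>. ennreal (excess t (L \<omega>)) \<partial>Q) + ennreal \<bar>s - t\<bar>"
      by (subst nn_integral_add) (auto simp: emeasure_space_1)
    finally show ?thesis by (simp add: less_eq_ennreal.rep_eq plus_ennreal.rep_eq enn2ereal_ennreal)
  qed
  have low: "ereal (0 + max 0 (prob {\<omega> \<in> space Q. m \<le> L \<omega>} * (m - t)))
      \<le> enn2ereal (\<integral>\<^sup>+\<omega>. ennreal (excess t (L \<omega>)) \<partial>Q)" for t
    unfolding add_0_left by (rule nn_integral_excess_ge[OF L])
  show ?thesis
    unfolding cvar_def cvar_objective_def
    by (rule INF_affine_plus_lipschitz_attained[OF \<alpha>(1) m lip low])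
qed

section \<open>The robust objective: attainment and domination of the CVaR\<close>

lemma enn2ereal_nn_integral_cmult:
  assumes "0 \<le> c" and [measurable]: "f \<in> borel_measurable M"
  shows "enn2ereal (\<integral>\<^sup>+x. ennreal (c * f x) \<partial>M) = ereal c * enn2ereal (\<integral>\<^sup>+x. ennreal (f x) \<partial>M)"
  using assms(1)
  by (simp add: ennreal_mult' nn_integral_cmult times_ennreal.rep_eq enn2ereal_ennreal)

text \<open>Splitting off 1 / \<alpha> gives the robust objective the shape of the CVaR objective,
  which serves both the attainment lemma and the comparison of the two at the same t.\<close>

lemma robust_objective_eq:
  "robust_objective \<alpha> \<eta> P L r t = ereal t + ereal (1 / \<alpha>) *
     (ereal (1 / \<eta>) * (r + ln_expectation P (\<lambda>\<omega>. exp (\<eta> * excess t (L \<omega>)))))"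
  by (simp add: robust_objective_def flip: mult.assoc)

text \<open>The log-expectation is Lipschitz in t with constant \<eta>, which the factor 1 / \<eta>
  reduces to 1. The lower bound has b = \<rho> / \<eta> and the same tail slope as for the
  CVaR.\<close>

lemma robust_bound_attained:
  fixes \<rho> :: real
  assumes P: "prob_space P" and L[measurable]: "L \<in> borel_measurable P"
    and \<alpha>: "0 < \<alpha>" "\<alpha> < 1" and \<eta>: "\<eta> > 0"
  shows "\<exists>t. robust_bound \<alpha> \<eta> P L \<rho> = robust_objective \<alpha> \<eta> P L \<rho> t"
proof -
  interpret prob_space P by fact
  let ?E = "\<lambda>t. ln_expectation P (\<lambda>\<omega>. exp (\<eta> * excess t (L \<omega>)))"
  have nn: "0 \<le> \<eta> * excess t (L \<omega>)" for t \<omega> using \<eta> by (simp add: excess_nonneg)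
  obtain m where m: "\<alpha> < prob {\<omega> \<in> space P. m \<le> L \<omega>}"
    using upper_tail_prob_gt[OF L \<alpha>(2)] .
  let ?q = "prob {\<omega> \<in> space P. m \<le> L \<omega>}"
  have lip: "ereal (1 / \<eta>) * (\<rho> + ?E s) \<le> ereal (1 / \<eta>) * (\<rho> + ?E t) + ereal \<bar>s - t\<bar>" for s t
  proof -
    have "?E s \<le> ?E t + ereal (\<eta> * \<bar>s - t\<bar>)"
    proof (rule ln_expectation_exp_le_add[OF P _ nn])
      fix \<omega>
      have "\<eta> * excess s (L \<omega>) \<le> \<eta> * (excess t (L \<omega>) + \<bar>s - t\<bar>)"
        using \<eta> by (intro mult_left_mono excess_le_add) auto
      then show "\<eta> * excess s (L \<omega>) \<le> \<eta> * excess t (L \<omega>) + \<eta> * \<bar>s - t\<bar>" by (simp add: algebra_simps)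
    qed measurable
    then have "ereal (1 / \<eta>) * (\<rho> + ?E s) \<le> ereal (1 / \<eta>) * (\<rho> + (?E t + ereal (\<eta> * \<bar>s - t\<bar>)))"
      using \<eta> by (intro ereal_mult_left_mono add_left_mono) auto
    also have "\<dots> = ereal (1 / \<eta>) * (\<rho> + ?E t) + ereal \<bar>s - t\<bar>"
      using \<eta> by (cases "?E t") (auto simp: add_divide_distrib)
    finally show ?thesis .
  qed
  have low: "ereal (\<rho> / \<eta> + max 0 (?q * (m - t))) \<le> ereal (1 / \<eta>) * (\<rho> + ?E t)" for t
  proof -
    have "ereal \<eta> * ereal (max 0 (?q * (m - t))) \<le> ereal \<eta> * enn2ereal (\<integral>\<^sup>+\<omega>. ennreal (excess t (L \<omega>)) \<partial>P)"
      using \<eta> by (intro ereal_mult_left_mono nn_integral_excess_ge L) simp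
    also have "\<dots> = enn2ereal (\<integral>\<^sup>+\<omega>. ennreal (\<eta> * excess t (L \<omega>)) \<partial>P)"
      using \<eta> by (subst enn2ereal_nn_integral_cmult) auto
    \<comment> \<open>With Q = P the variational inequality reduces to Jensen's: the mean of the
      scaled excess is below the log-expectation.\<close>
    also have "\<dots> \<le> kl_div P P + ?E t"
      by (rule donsker_varadhan_nonneg[OF P P refl _ nn]) measurable
    also have "\<dots> \<le> 0 + ?E t" by (rule add_right_mono[OF kl_div_self[OF P]])
    finally have "ereal (\<eta> * max 0 (?q * (m - t))) \<le> ?E t"
      unfolding times_ereal.simps add_0_left .
    then have "ereal (1 / \<eta>) * (\<rho> + ereal (\<eta> * max 0 (?q * (m - t)))) \<le> ereal (1 / \<eta>) * (\<rho> + ?E t)"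
      using \<eta> by (intro ereal_mult_left_mono add_left_mono) auto
    moreover have "ereal (1 / \<eta>) * (\<rho> + ereal (\<eta> * max 0 (?q * (m - t)))) = ereal (\<rho> / \<eta> + max 0 (?q * (m - t)))"
      using \<eta> unfolding plus_ereal.simps times_ereal.simps by (simp add: add_divide_distrib)
    ultimately show ?thesis by simp
  qed
  show ?thesis
    unfolding robust_bound_def robust_objective_eq
    by (rule INF_affine_plus_lipschitz_attained[OF \<alpha>(1) m lip low])
qed

text \<open>Both sides are infima over t, so it suffices to compare the objectives at the same t,
  where the variational inequality for \<eta> times the excess is divided by \<eta>. The radius is
  extended real because one derived from a penalty may be infinite.\<close>

lemma cvar_le_robust_bound:
  assumes P: "prob_space P" and L[measurable]: "L \<in> borel_measurable P"
    and \<alpha>: "0 < \<alpha>" and \<eta>: "\<eta> > 0" and Q: "Q \<in> kl_ball P r"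
  shows "cvar \<alpha> Q L \<le> robust_bound \<alpha> \<eta> P L r"
  unfolding cvar_def robust_bound_def
proof (rule INF_mono, rule bexI)
  fix t
  from Q have pQ: "prob_space Q" and sQ: "sets Q = sets P" and kl: "kl_div Q P \<le> r"
    by (auto simp: kl_ball_def)
  have [measurable]: "L \<in> borel_measurable Q" using L sQ by (simp cong: measurable_cong_sets)
  have nn: "0 \<le> \<eta> * excess t (L \<omega>)" for \<omega> using \<eta> by (simp add: excess_nonneg)
  let ?E = "ln_expectation P (\<lambda>\<omega>. exp (\<eta> * excess t (L \<omega>)))"
  let ?I = "enn2ereal (\<integral>\<^sup>+\<omega>. ennreal (excess t (L \<omega>)) \<partial>Q)"
  have "ereal \<eta> * ?I = enn2ereal (\<integral>\<^sup>+\<omega>. ennreal (\<eta> * excess t (L \<omega>)) \<partial>Q)"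
    using \<eta> by (subst enn2ereal_nn_integral_cmult) auto
  also have "\<dots> \<le> kl_div Q P + ?E"
    by (rule donsker_varadhan_nonneg[OF P pQ sQ _ nn]) measurable
  also have "\<dots> \<le> r + ?E" by (rule add_right_mono[OF kl])
  finally have "ereal (1 / \<eta>) * (ereal \<eta> * ?I) \<le> ereal (1 / \<eta>) * (r + ?E)"
    using \<eta> by (intro ereal_mult_left_mono) auto
  then have "?I \<le> ereal (1 / \<eta>) * (r + ?E)"
    using \<eta> by (simp flip: mult.assoc add: one_ereal_def[symmetric])
  then show "cvar_objective \<alpha> Q L t \<le> robust_objective \<alpha> \<eta> P L r t"
    unfolding cvar_objective_def robust_objective_eq
    using \<alpha> by (intro add_left_mono ereal_mult_left_mono) auto
qed simp

lemma robust_bound_mono: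
  assumes "0 < \<alpha>" "0 < \<eta>" "r \<le> r'"
  shows "robust_bound \<alpha> \<eta> P L r \<le> robust_bound \<alpha> \<eta> P L r'"
  unfolding robust_bound_def robust_objective_def
  by (rule INF_mono) (use assms in \<open>auto intro!: exI add_left_mono add_right_mono ereal_mult_left_mono\<close>)

text \<open>The definitions use infima, hence the attainment clauses. The last clause makes precise
  how a penalty controls the bound: \<open>H / lam\<close> times the penalty serves as the radius,
  because it dominates the divergence between the path laws of the policy and of the reference
  policy.\<close>

theorem theorem2:
  fixes X :: "'s measure" and A :: "'a measure"
    and \<mu> :: "'s measure" and K :: "nat \<Rightarrow> 's \<times> 'a \<Rightarrow> 's measure" and H :: nat
    and \<pi>' \<pi>\<^sub>r\<^sub>e\<^sub>f :: "'s \<Rightarrow> 'a measure"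
    and P :: "((nat \<Rightarrow> 's) \<times> (nat \<Rightarrow> 'a)) measure"
    and L :: "(nat \<Rightarrow> 's) \<times> (nat \<Rightarrow> 'a) \<Rightarrow> real"
    and \<alpha> \<eta> \<rho> :: real
  assumes "controlled_process X A \<mu> K" and "H \<ge> 1"
    and "policy X A \<pi>'" and "policy X A \<pi>\<^sub>r\<^sub>e\<^sub>f"
    and "P \<in> space (prob_algebra (path_space X A H))"
    and "L \<in> borel_measurable (path_space X A H)"
    and "0 < \<alpha>" and "\<alpha> < 1" and "\<eta> > 0"
  shows
    "(\<forall>Q \<in> kl_ball P \<rho>. \<exists>t. cvar \<alpha> Q L = cvar_objective \<alpha> Q L t) \<and>
     (\<exists>t. robust_bound \<alpha> \<eta> P L \<rho> = robust_objective \<alpha> \<eta> P L \<rho> t) \<and>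
     (SUP Q \<in> kl_ball P \<rho>. cvar \<alpha> Q L) \<le> robust_bound \<alpha> \<eta> P L \<rho> \<and>
     (\<forall>\<beta> C_occ :: real.
        (AE x in state_occupancy X A \<mu> K \<pi>' H. kl_div (\<pi>' x) (\<pi>\<^sub>r\<^sub>e\<^sub>f x) \<le> \<beta>) \<longrightarrow>
        \<rho> \<le> C_occ * \<beta> \<longrightarrow>
        robust_bound \<alpha> \<eta> P L \<rho> \<le> robust_bound \<alpha> \<eta> P L (C_occ * \<beta>) \<and>
        (SUP Q \<in> kl_ball P \<rho>. cvar \<alpha> Q L) \<le> robust_bound \<alpha> \<eta> P L (C_occ * \<beta>)) \<and>
     (\<forall>\<pi> (lam :: real) r.
        policy X A \<pi> \<longrightarrow>
        (\<lambda>x. kl_div (\<pi> x) (\<pi>\<^sub>r\<^sub>e\<^sub>f x)) \<in> borel_measurable X \<longrightarrow>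
        P = path_law X A \<mu> K \<pi>\<^sub>r\<^sub>e\<^sub>f H \<longrightarrow>
        lam > 0 \<longrightarrow>
        r = ereal (H / lam) * kl_penalty lam (state_occupancy X A \<mu> K \<pi> H) \<pi> \<pi>\<^sub>r\<^sub>e\<^sub>f \<longrightarrow>
        path_law X A \<mu> K \<pi> H \<in> kl_ball P r \<and>
        cvar \<alpha> (path_law X A \<mu> K \<pi> H) L \<le> (SUP Q \<in> kl_ball P r. cvar \<alpha> Q L) \<and>
        (SUP Q \<in> kl_ball P r. cvar \<alpha> Q L) \<le> robust_bound \<alpha> \<eta> P L r)"
proof -
  interpret controlled_process X A \<mu> K by fact
  from assms(5) have P: "prob_space P" and sP: "sets P = sets (path_space X A H)"
    by (auto simp: space_prob_algebra)
  have L: "L \<in> borel_measurable P"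
    using assms(6) sP by (simp cong: measurable_cong_sets)
  have L_ball: "prob_space Q" "L \<in> borel_measurable Q" if "Q \<in> kl_ball P r" for Q r
    using that L by (auto simp: kl_ball_def cong: measurable_cong_sets)
  have sup: "(SUP Q \<in> kl_ball P r. cvar \<alpha> Q L) \<le> robust_bound \<alpha> \<eta> P L r" for r
    by (intro SUP_least cvar_le_robust_bound[OF P L assms(7,9)])
  have mono: "robust_bound \<alpha> \<eta> P L \<rho> \<le> robust_bound \<alpha> \<eta> P L (C_occ * \<beta>)"
    if "\<rho> \<le> C_occ * \<beta>" for C_occ \<beta>
    by (rule robust_bound_mono[OF assms(7,9)]) (use that in simp)
  have ball: "path_law X A \<mu> K \<pi> H \<in> kl_ball P r"
    if "policy X A \<pi>" "(\<lambda>x. kl_div (\<pi> x) (\<pi>\<^sub>r\<^sub>e\<^sub>f x)) \<in> borel_measurable X"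
      "P = path_law X A \<mu> K \<pi>\<^sub>r\<^sub>e\<^sub>f H" "lam > 0"
      "r = ereal (H / lam) * kl_penalty lam (state_occupancy X A \<mu> K \<pi> H) \<pi> \<pi>\<^sub>r\<^sub>e\<^sub>f" for \<pi> lam r
    using kl_div_path_law_le_kl_penalty[OF that(1) assms(4) that(2) assms(2) that(4)]
      path_law_prob_algebra[OF that(1), of H] sP that(3,5)
    by (simp add: kl_ball_def space_prob_algebra)
  show ?thesis
  proof (intro conjI ballI allI impI)
    show "\<exists>t. cvar \<alpha> Q L = cvar_objective \<alpha> Q L t" if "Q \<in> kl_ball P \<rho>" for Q
      by (rule cvar_attained[OF L_ball[OF that] assms(7,8)])
    show "\<exists>t. robust_bound \<alpha> \<eta> P L \<rho> = robust_objective \<alpha> \<eta> P L \<rho> t"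
      by (rule robust_bound_attained[OF P L assms(7-9)])
    show "cvar \<alpha> (path_law X A \<mu> K \<pi> H) L \<le> (SUP Q \<in> kl_ball P r. cvar \<alpha> Q L)"
      if "policy X A \<pi>" "(\<lambda>x. kl_div (\<pi> x) (\<pi>\<^sub>r\<^sub>e\<^sub>f x)) \<in> borel_measurable X"
        "P = path_law X A \<mu> K \<pi>\<^sub>r\<^sub>e\<^sub>f H" "lam > 0"
        "r = ereal (H / lam) * kl_penalty lam (state_occupancy X A \<mu> K \<pi> H) \<pi> \<pi>\<^sub>r\<^sub>e\<^sub>f" for \<pi> lam r
      by (rule SUP_upper[OF ball[OF that]])
  \<comment> \<open>The bound at radius \<open>C_occ * \<beta>\<close> combines \<open>sup\<close>
    at radius \<rho> with monotonicity in the radius; the ball itself stays that of radius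
    \<rho>.\<close>
  qed (rule sup | (rule mono ball order_trans[OF sup mono], assumption+))+
qed

end
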